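(* Let $H=\langle x_1,x_2,x_3\mid [x_1,x_2]=x_3\rangle$ be the Heisenberg Lie ring. For every prime $p$, $$\zeta_{H(\mathbb{F}_p)}^{\triangleleft}(s)=1+(1+p)t+t^2+t^3,\qquad \zeta_{H(\mathbb{F}_p)}^{\leq}(s)=1+(1+p)t+(1+p+p^2)t^2+t^3.$$
   Context: A presentation of a Lie ring lists a $\mathbb{Z}$-module basis together with brackets of basis elements; all brackets not listed are zero, up to antisymmetry. For a Lie ring $L\cong\mathbb{Z}^n$ (additively) and a prime $p$, $L(\mathbb{F}_p)=L\otimes_{\mathbb{Z}}\mathbb{F}_p$, and for $*\in\{\leq,\triangleleft\}$, $\zeta_{L(\mathbb{F}_p)}^{*}(s)=\sum_{i=0}^{n}a_{p^i}^{*}(L(\mathbb{F}_p))\,t^{i}$, where $t=p^{-s}$ and $a_{p^i}^{*}(L(\mathbb{F}_p))$ is the number of $\mathbb{F}_p$-Lie subalgebras ($*=\leq$) or ideals ($*=\triangleleft$) of $L(\mathbb{F}_p)$ of codimension $i$ (index $p^i$). *)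

theory Defs
  imports "HOL-Analysis.Complex_Transcendental" "HOL-Algebra.Free_Abelian_Groups" "HOL-Algebra.IntRing"
    "HOL-Number_Theory.Residues"
begin

section \<open>Lie algebras over a commutative ring\<close>

text \<open>
  As in the library's \<^typ>\<open>('a, 'b) module\<close>, the fields \<open>mult\<close> and \<open>one\<close> inherited from
  rings play no role. A Lie ring is a Lie algebra over the integers.
\<close>

record ('a, 'b) lie_algebra = "('a, 'b) module" +
  lie_bracket :: "'b \<Rightarrow> 'b \<Rightarrow> 'b"

locale lie_algebra = module R L 
    for R (structure) and L :: "('a, 'b, 'n) lie_algebra_scheme" (structure) +
  assumes bracket_closed:
      "\<lbrakk>x \<in> carrier L; y \<in> carrier L\<rbrakk> \<Longrightarrow> lie_bracket L x y \<in> carrier L"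
    and bracket_add_left:
      "\<lbrakk>x \<in> carrier L; y \<in> carrier L; z \<in> carrier L\<rbrakk> \<Longrightarrow>
        lie_bracket L (x \<oplus>\<^bsub>L\<^esub> y) z = lie_bracket L x z \<oplus>\<^bsub>L\<^esub> lie_bracket L y z"
    and bracket_add_right:
      "\<lbrakk>x \<in> carrier L; y \<in> carrier L; z \<in> carrier L\<rbrakk> \<Longrightarrow>
        lie_bracket L x (y \<oplus>\<^bsub>L\<^esub> z) = lie_bracket L x y \<oplus>\<^bsub>L\<^esub> lie_bracket L x z"
    and bracket_smult_left:
      "\<lbrakk>a \<in> carrier R; x \<in> carrier L; y \<in> carrier L\<rbrakk> \<Longrightarrow>
        lie_bracket L (a \<odot>\<^bsub>L\<^esub> x) y = a \<odot>\<^bsub>L\<^esub> lie_bracket L x y"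
    and bracket_smult_right:
      "\<lbrakk>a \<in> carrier R; x \<in> carrier L; y \<in> carrier L\<rbrakk> \<Longrightarrow>
        lie_bracket L x (a \<odot>\<^bsub>L\<^esub> y) = a \<odot>\<^bsub>L\<^esub> lie_bracket L x y"
    and bracket_self: "x \<in> carrier L \<Longrightarrow> lie_bracket L x x = \<zero>\<^bsub>L\<^esub>"
    and jacobi:
      "\<lbrakk>x \<in> carrier L; y \<in> carrier L; z \<in> carrier L\<rbrakk> \<Longrightarrow>
        lie_bracket L x (lie_bracket L y z) \<oplus>\<^bsub>L\<^esub> lie_bracket L y (lie_bracket L z x)
          \<oplus>\<^bsub>L\<^esub> lie_bracket L z (lie_bracket L x y) = \<zero>\<^bsub>L\<^esub>"

definition lie_subalgebra ::
    "'b set \<Rightarrow> ('a, 'm) ring_scheme \<Rightarrow> ('a, 'b, 'n) lie_algebra_scheme \<Rightarrow> bool" where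
  "lie_subalgebra M R L \<longleftrightarrow>
     submodule M R L \<and> (\<forall>x\<in>M. \<forall>y\<in>M. lie_bracket L x y \<in> M)"

definition lie_ideal ::
    "'b set \<Rightarrow> ('a, 'm) ring_scheme \<Rightarrow> ('a, 'b, 'n) lie_algebra_scheme \<Rightarrow> bool" where
  "lie_ideal M R L \<longleftrightarrow>
     submodule M R L \<and> (\<forall>x\<in>carrier L. \<forall>y\<in>M. lie_bracket L x y \<in> M)"

text \<open>
  Counting by the additive index \<open>m\<close>. Over a field with \<open>p\<close> elements,
  codimension \<open>i\<close> is the same as index \<open>p ^ i\<close>.
\<close>

definition num_subalgebras ::
    "('a, 'm) ring_scheme \<Rightarrow> ('a, 'b, 'n) lie_algebra_scheme \<Rightarrow> nat \<Rightarrow> nat" where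
  "num_subalgebras R L m = card {M. lie_subalgebra M R L \<and> card (a_rcosets\<^bsub>L\<^esub> M) = m}"

definition num_ideals ::
    "('a, 'm) ring_scheme \<Rightarrow> ('a, 'b, 'n) lie_algebra_scheme \<Rightarrow> nat \<Rightarrow> nat" where
  "num_ideals R L m = card {M. lie_ideal M R L \<and> card (a_rcosets\<^bsub>L\<^esub> M) = m}"


section \<open>Presentations of Lie rings\<close>

text \<open>
  The Lie ring with basis \<open>x\<^sub>1, \<dots>, x\<^sub>n\<close> and listed brackets \<open>B\<close>: here
  \<open>B (i, j) = Some v\<close> records the relation \<open>[x\<^sub>i, x\<^sub>j] = v\<close>. The additive group is the free
  abelian group on \<open>{1..n}\<close>, with \<open>x\<^sub>i\<close> represented by \<open>frag_of i\<close>.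
\<close>

definition basis_bracket :: "(nat \<times> nat \<rightharpoonup> (nat \<Rightarrow>\<^sub>0 int)) \<Rightarrow> nat \<Rightarrow> nat \<Rightarrow> (nat \<Rightarrow>\<^sub>0 int)" where
  "basis_bracket B i j =
     (case B (i, j) of Some v \<Rightarrow> v
      | None \<Rightarrow> (case B (j, i) of Some v \<Rightarrow> - v | None \<Rightarrow> 0))"

definition presented_lie_ring ::
    "nat \<Rightarrow> (nat \<times> nat \<rightharpoonup> (nat \<Rightarrow>\<^sub>0 int)) \<Rightarrow> (int, nat \<Rightarrow>\<^sub>0 int) lie_algebra" where
  "presented_lie_ring n B =
     \<lparr>carrier = carrier (free_Abelian_group {1..n}), monoid.mult = undefined, one = undefined,
      ring.zero = 0, ring.add = (+), smult = frag_cmul,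
      lie_bracket = (\<lambda>u v. frag_extend (\<lambda>i. frag_extend (\<lambda>j. basis_bracket B i j) v) u)\<rparr>"

definition heisenberg :: "(int, nat \<Rightarrow>\<^sub>0 int) lie_algebra" where
  "heisenberg = presented_lie_ring 3 [(1, 2) \<mapsto> frag_of 3]"

lemma abelian_group_presented: "abelian_group (presented_lie_ring n B)" (is "abelian_group ?L")
proof (rule abelian_groupI)
  fix x assume "x \<in> carrier ?L"
  then show "\<exists>y\<in>carrier ?L. y \<oplus>\<^bsub>?L\<^esub> x = \<zero>\<^bsub>?L\<^esub>"
    by (intro bexI[of _ "-x"]) (auto simp: presented_lie_ring_def)
next
  fix x y assume "x \<in> carrier ?L" "y \<in> carrier ?L"
  then show "x \<oplus>\<^bsub>?L\<^esub> y \<in> carrier ?L"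
    using keys_add[of x y] by (simp add: presented_lie_ring_def) blast
qed (auto simp: presented_lie_ring_def algebra_simps)

lemma frag_extend_delta: "frag_extend (\<lambda>j. if j = k then w else 0) v = frag_cmul (Poly_Mapping.lookup v k) w"
proof -
  have "frag_extend (\<lambda>j. if j = k then w else 0) v
      = (\<Sum>j\<in>Poly_Mapping.keys v. if j = k then frag_cmul (Poly_Mapping.lookup v j) w else 0)"
    unfolding frag_extend_def by (rule sum.cong) auto
  then show ?thesis by (auto simp: not_in_keys_iff_lookup_eq_zero)
qed

lemma lie_algebra_heisenberg: "lie_algebra \<Z> heisenberg"
proof -
  have br: "lie_bracket heisenberg u v =
      frag_cmul (Poly_Mapping.lookup u 1 * Poly_Mapping.lookup v 2 - Poly_Mapping.lookup u 2 * Poly_Mapping.lookup v 1) (frag_of 3)" for u v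
  proof -
    have "frag_extend (\<lambda>j. basis_bracket [(1, 2) \<mapsto> frag_of 3] i j) v
        = (if i = 1 then frag_cmul (Poly_Mapping.lookup v 2) (frag_of 3) else 0)
        + (if i = 2 then frag_cmul (- Poly_Mapping.lookup v 1) (frag_of 3) else 0)" for i :: nat
    proof -
      have neg: "frag_cmul a (- w) = frag_cmul (- a) w" for a and w :: "nat \<Rightarrow>\<^sub>0 int"
        by (rule poly_mapping_eqI) simp
      have "basis_bracket [(1, 2) \<mapsto> frag_of 3] i =
        (if i = 1 then (\<lambda>j::nat. if j = 2 then frag_of 3 else 0) else if i = 2 then (\<lambda>j. if j = 1 then - frag_of 3 else 0) else (\<lambda>_. 0))"
        by (auto simp: basis_bracket_def fun_eq_iff)
      then show ?thesis by (simp add: frag_extend_delta frag_extend_eq_0 neg del: One_nat_def)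
    qed
    moreover have "frag_extend (\<lambda>i. f i + g i) w = frag_extend f w + frag_extend g w"
      for f g :: "nat \<Rightarrow> nat \<Rightarrow>\<^sub>0 int" and w
      by (simp add: frag_extend_def frag_cmul_distrib2 sum.distrib)
    ultimately show ?thesis
      by (auto simp: heisenberg_def presented_lie_ring_def frag_extend_delta frag_cmul_distrib[symmetric] algebra_simps)
  qed
  have c: "carrier heisenberg = {x. Poly_Mapping.keys x \<subseteq> {1..3}}"
    by (auto simp: heisenberg_def presented_lie_ring_def free_Abelian_group_def)
  have pl: "x \<oplus>\<^bsub>heisenberg\<^esub> y = x + y" for x y by (simp add: heisenberg_def presented_lie_ring_def)
  have ze: "\<zero>\<^bsub>heisenberg\<^esub> = 0" by (simp add: heisenberg_def presented_lie_ring_def)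
  have sm: "a \<odot>\<^bsub>heisenberg\<^esub> y = frag_cmul a y" for a y by (simp add: heisenberg_def presented_lie_ring_def)
  have ab: "abelian_group heisenberg" by (simp add: heisenberg_def abelian_group_presented)
  have "module \<Z> heisenberg"
    by (rule moduleI)
       (use keys_cmul in \<open>force simp: c sm pl ab int_is_cring frag_cmul_distrib frag_cmul_distrib2\<close>)+
  moreover have "lie_algebra_axioms \<Z> heisenberg"
  proof
    fix x y assume "x \<in> carrier heisenberg" "y \<in> carrier heisenberg"
    show "lie_bracket heisenberg x y \<in> carrier heisenberg" by (auto simp: c br)
  qed (auto simp: br sm pl ze lookup_add algebra_simps intro!: poly_mapping_eqI)
  ultimately show ?thesis by (rule lie_algebra.intro)
qed


section \<open>Extension of scalars\<close>

text \<open>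
  The tensor product \<open>L \<otimes> R\<close> over the integers, as the free abelian group on pairs \<open>(x, a)\<close>
  modulo the subgroup generated by the biadditivity relations.
\<close>

definition tensor_free ::
    "(int, 'b, 'n) lie_algebra_scheme \<Rightarrow> ('a, 'm) ring_scheme \<Rightarrow> ('b \<times> 'a \<Rightarrow>\<^sub>0 int) monoid" where
  "tensor_free L R = free_Abelian_group (carrier L \<times> carrier R)"

definition tensor_relations ::
    "(int, 'b, 'n) lie_algebra_scheme \<Rightarrow> ('a, 'm) ring_scheme \<Rightarrow> ('b \<times> 'a \<Rightarrow>\<^sub>0 int) set" where
  "tensor_relations L R = generate (tensor_free L R)
     ({frag_of (x \<oplus>\<^bsub>L\<^esub> y, a) - frag_of (x, a) - frag_of (y, a) | x y a.
         x \<in> carrier L \<and> y \<in> carrier L \<and> a \<in> carrier R} \<union>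
      {frag_of (x, a \<oplus>\<^bsub>R\<^esub> b) - frag_of (x, a) - frag_of (x, b) | x a b.
         x \<in> carrier L \<and> a \<in> carrier R \<and> b \<in> carrier R})"

text \<open>
  \<open>L \<otimes> R\<close> as a Lie algebra over \<open>R\<close>: the operations are induced by
  \<open>c (x \<otimes> a) = x \<otimes> c a\<close> and \<open>[x \<otimes> a, y \<otimes> b] = [x, y] \<otimes> a b\<close>, extended
  additively to formal sums. The elements are cosets of \<open>tensor_relations L R\<close>; since the
  operations respect the relations, the unions below range over equal cosets.
\<close>

definition extend_scalars ::
    "(int, 'b, 'n) lie_algebra_scheme \<Rightarrow> ('a, 'm) ring_scheme
      \<Rightarrow> ('a, ('b \<times> 'a \<Rightarrow>\<^sub>0 int) set) lie_algebra" where
  "extend_scalars L R =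
     (let F = tensor_free L R; K = tensor_relations L R in
      \<lparr>carrier = carrier (F Mod K), monoid.mult = undefined, one = undefined,
       ring.zero = \<one>\<^bsub>F Mod K\<^esub>, ring.add = (\<otimes>\<^bsub>F Mod K\<^esub>),
       smult = (\<lambda>c X. \<Union>f\<in>X. K #>\<^bsub>F\<^esub> frag_extend (\<lambda>(x, a). frag_of (x, c \<otimes>\<^bsub>R\<^esub> a)) f),
       lie_bracket = (\<lambda>X Y. \<Union>f\<in>X. \<Union>g\<in>Y. K #>\<^bsub>F\<^esub>
         frag_extend (\<lambda>(x, a). frag_extend (\<lambda>(y, b).
           frag_of (lie_bracket L x y, a \<otimes>\<^bsub>R\<^esub> b)) g) f)\<rparr>)"


section \<open>Zeta functions over prime fields\<close>

definition lie_rank :: "(int, 'b, 'n) lie_algebra_scheme \<Rightarrow> nat" where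
  "lie_rank L = (THE n. add_monoid L \<cong> free_Abelian_group {1..n})"

text \<open>
  The rank is well defined: the group \<open>G / 2 G\<close> for \<open>G\<close> free abelian on
  \<open>{1..n}\<close> has \<open>2 ^ n\<close> elements.
\<close>

lemma card_double_cosets_iso:
  fixes G :: "('a, 'm) monoid_scheme" and H :: "('b, 'n) monoid_scheme"
  assumes h: "h \<in> iso G H" and G: "group G"
  shows "card ((\<lambda>x. {y \<in> carrier G. \<exists>z\<in>carrier G. y = x \<otimes>\<^bsub>G\<^esub> z \<otimes>\<^bsub>G\<^esub> z}) ` carrier G)
       = card ((\<lambda>x. {y \<in> carrier H. \<exists>z\<in>carrier H. y = x \<otimes>\<^bsub>H\<^esub> z \<otimes>\<^bsub>H\<^esub> z}) ` carrier H)"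
    (is "card (?D ` _) = card (?E ` _)")
proof -
  interpret G: group G by (rule G)
  have hom: "h (x \<otimes>\<^bsub>G\<^esub> y) = h x \<otimes>\<^bsub>H\<^esub> h y" if "x \<in> carrier G" "y \<in> carrier G" for x y
    using h that by (auto simp: iso_def hom_def)
  have bij: "bij_betw h (carrier G) (carrier H)" using h by (simp add: iso_def)
  then have im: "h ` carrier G = carrier H" and inj: "inj_on h (carrier G)" by (auto simp: bij_betw_def)
  have E: "?E (h x) = h ` ?D x" if x: "x \<in> carrier G" for x
  proof -
    have "?E (h x) = {y \<in> carrier H. \<exists>z\<in>carrier G. y = h (x \<otimes>\<^bsub>G\<^esub> z \<otimes>\<^bsub>G\<^esub> z)}"
      unfolding im[symmetric] using x by (simp add: hom)
    also have "\<dots> = h ` ?D x"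
    proof (intro equalityI subsetI)
      fix y assume "y \<in> {y \<in> carrier H. \<exists>z\<in>carrier G. y = h (x \<otimes>\<^bsub>G\<^esub> z \<otimes>\<^bsub>G\<^esub> z)}"
      then obtain z where "z \<in> carrier G" "y = h (x \<otimes>\<^bsub>G\<^esub> z \<otimes>\<^bsub>G\<^esub> z)" by blast
      moreover from this x have "x \<otimes>\<^bsub>G\<^esub> z \<otimes>\<^bsub>G\<^esub> z \<in> ?D x" by blast
      ultimately show "y \<in> h ` ?D x" by blast
    next
      fix y assume "y \<in> h ` ?D x"
      then show "y \<in> {y \<in> carrier H. \<exists>z\<in>carrier G. y = h (x \<otimes>\<^bsub>G\<^esub> z \<otimes>\<^bsub>G\<^esub> z)}"
        using im by blast
    qed
    finally show ?thesis .
  qed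
  have "?E ` carrier H = (`) h ` ?D ` carrier G"
  proof -
    have "?E ` carrier H = ?E ` (h ` carrier G)"
      by (rule arg_cong[where f = "\<lambda>A. ?E ` A", OF im[symmetric]])
    also have "\<dots> = (\<lambda>x. ?E (h x)) ` carrier G"
      by (rule image_image)
    also have "\<dots> = (\<lambda>x. h ` ?D x) ` carrier G"
      by (rule image_cong[OF refl E])
    also have "\<dots> = (`) h ` ?D ` carrier G"
      by (rule image_image[symmetric])
    finally show ?thesis .
  qed
  moreover have "inj_on ((`) h) (?D ` carrier G)"
    by (rule inj_on_subset[OF inj_on_image_Pow[OF inj]]) auto
  ultimately show ?thesis by (simp only: card_image)
qed

lemma card_double_cosets_free:
  "card ((\<lambda>x. {y \<in> carrier (free_Abelian_group {1..n::nat}). \<exists>z\<in>carrier (free_Abelian_group {1..n}).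
      y = x \<otimes>\<^bsub>free_Abelian_group {1..n}\<^esub> z \<otimes>\<^bsub>free_Abelian_group {1..n}\<^esub> z}) ` carrier (free_Abelian_group {1..n})) = 2 ^ n"
proof -
  let ?F = "free_Abelian_group {1..n}"
  define par where "par x = {i \<in> {1..n}. odd (Poly_Mapping.lookup x i)}" for x :: "nat \<Rightarrow>\<^sub>0 int"
  define cl where "cl P = {y \<in> carrier ?F. par y = P}" for P
  have eq: "{y \<in> carrier ?F. \<exists>z\<in>carrier ?F. y = x + z + z} = cl (par x)"
    if x: "x \<in> carrier ?F" for x
  proof (intro equalityI subsetI)
    fix y assume "y \<in> {y \<in> carrier ?F. \<exists>z\<in>carrier ?F. y = x + z + z}"
    then obtain z where y: "y \<in> carrier ?F" "y = x + z + z" by blast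
    then have "even (Poly_Mapping.lookup y i - Poly_Mapping.lookup x i)" for i by (simp only: lookup_add) simp
    then show "y \<in> cl (par x)" using y(1) by (simp add: cl_def par_def)
  next
    fix y assume "y \<in> cl (par x)"
    then have y: "y \<in> carrier ?F" and p: "par y = par x" by (auto simp: cl_def)
    define z where "z = (\<Sum>i\<in>{1..n}. frag_cmul ((Poly_Mapping.lookup y i - Poly_Mapping.lookup x i) div 2) (frag_of i))"
    have lz: "Poly_Mapping.lookup z j = (if j \<in> {1..n} then (Poly_Mapping.lookup y j - Poly_Mapping.lookup x j) div 2 else 0)" for j
    proof -
      have "Poly_Mapping.lookup z j = (\<Sum>i\<in>{1..n}.
          if i = j then (Poly_Mapping.lookup y i - Poly_Mapping.lookup x i) div 2 else 0)"
        unfolding z_def lookup_sum by (rule sum.cong) auto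
      then show ?thesis by simp
    qed
    have zc: "z \<in> carrier ?F" using lz by (auto simp: in_keys_iff split: if_splits)
    have out: "Poly_Mapping.lookup w j = 0" if "w \<in> carrier ?F" "j \<notin> {1..n}" for w j
      using that by (auto simp: in_keys_iff subset_iff)
    have "Poly_Mapping.lookup y j = Poly_Mapping.lookup x j + Poly_Mapping.lookup z j + Poly_Mapping.lookup z j" for j
    proof (cases "j \<in> {1..n}")
      case True
      then have "even (Poly_Mapping.lookup y j - Poly_Mapping.lookup x j)" using p unfolding par_def by auto
      moreover have "Poly_Mapping.lookup z j = (Poly_Mapping.lookup y j - Poly_Mapping.lookup x j) div 2"
        using True lz[of j] by (simp only: if_True)
      ultimately show ?thesis by presburger
    next
      case False
      then show ?thesis using out[OF x False] out[OF y False] lz[of j] by auto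
    qed
    then have "y = x + z + z" by (intro poly_mapping_eqI) (simp only: lookup_add)
    then show "y \<in> {y \<in> carrier ?F. \<exists>z\<in>carrier ?F. y = x + z + z}" using zc y by blast
  qed
  have sur: "\<exists>x\<in>carrier ?F. par x = P" if "P \<subseteq> {1..n}" for P
  proof -
    have fP: "finite P" using that finite_subset by blast
    define x where "x = (\<Sum>i\<in>P. frag_of i)"
    have lx: "Poly_Mapping.lookup x j = (if j \<in> P then 1 else 0)" for j
      using fP by (simp add: x_def lookup_sum)
    have "Poly_Mapping.keys x = P" by (rule Set.set_eqI) (simp add: in_keys_iff lx)
    moreover have "par x = P" unfolding par_def lx using that by auto
    ultimately show ?thesis using that by (intro bexI[of _ x]) simp_all
  qed
  have par: "par ` carrier ?F = Pow {1..n}"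
  proof
    show "par ` carrier ?F \<subseteq> Pow {1..n}" unfolding par_def by blast
    show "Pow {1..n} \<subseteq> par ` carrier ?F" using sur by blast
  qed
  have "(\<lambda>x. {y \<in> carrier ?F. \<exists>z\<in>carrier ?F. y = x + z + z}) ` carrier ?F = cl ` Pow {1..n}"
  proof -
    have "(\<lambda>x. {y \<in> carrier ?F. \<exists>z\<in>carrier ?F. y = x + z + z}) ` carrier ?F
        = (\<lambda>x. cl (par x)) ` carrier ?F"
      by (rule image_cong[OF refl eq])
    also have "\<dots> = cl ` (par ` carrier ?F)" by (rule image_image[symmetric])
    finally show ?thesis unfolding par .
  qed
  moreover have "inj_on cl (Pow {1..n})"
  proof (rule inj_onI)
    fix P Q assume "P \<in> Pow {1..n}" "Q \<in> Pow {1..n}" "cl P = cl Q"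
    then show "P = Q" using sur[of P] unfolding cl_def by blast
  qed
  ultimately show ?thesis unfolding mult_free_Abelian_group by (simp only: card_image) (simp add: card_Pow)
qed

lemma lie_rank_eqI:
  fixes n :: nat
  assumes "add_monoid L \<cong> free_Abelian_group {1..n}" and L: "abelian_group L"
  shows "lie_rank L = n"
  unfolding lie_rank_def
proof (rule the_equality)
  fix m :: nat assume m: "add_monoid L \<cong> free_Abelian_group {1..m}"
  then obtain h where h: "h \<in> iso (add_monoid L) (free_Abelian_group {1..m})" by (auto simp: is_iso_def)
  obtain g where g: "g \<in> iso (add_monoid L) (free_Abelian_group {1..n})" using assms by (auto simp: is_iso_def)
  have "group (add_monoid L)"
    using L by (simp add: abelian_group.a_group)
  from card_double_cosets_iso[OF h this] card_double_cosets_iso[OF g this]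
  have "(2::nat) ^ m = 2 ^ n" unfolding card_double_cosets_free by simp
  then show "m = n" by simp
qed (use assms in auto)

lemma lie_rank_presented: "lie_rank (presented_lie_ring n B) = n"
proof (rule lie_rank_eqI[OF is_isoI abelian_group_presented])
  show "id \<in> iso (add_monoid (presented_lie_ring n B)) (free_Abelian_group {1..n})"
    by (simp add: presented_lie_ring_def iso_def hom_def)
qed

text \<open>
  \<open>L(\<bbbF>\<^sub>p)\<close>, with \<open>\<bbbF>\<^sub>p\<close> the ring of residues modulo \<open>p\<close>.
\<close>

definition Fp_points ::
    "(int, 'b, 'n) lie_algebra_scheme \<Rightarrow> nat \<Rightarrow> (int, ('b \<times> int \<Rightarrow>\<^sub>0 int) set) lie_algebra" where
  "Fp_points L p = extend_scalars L (residue_ring (int p))"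

definition zeta_ideal :: "(int, 'b, 'n) lie_algebra_scheme \<Rightarrow> nat \<Rightarrow> complex \<Rightarrow> complex" where
  "zeta_ideal L p s =
     (\<Sum>i = 0..lie_rank L.
        of_nat (num_ideals (residue_ring (int p)) (Fp_points L p) (p ^ i)) * (of_nat p powr (- s)) ^ i)"

definition zeta_subalgebra :: "(int, 'b, 'n) lie_algebra_scheme \<Rightarrow> nat \<Rightarrow> complex \<Rightarrow> complex" where
  "zeta_subalgebra L p s =
     (\<Sum>i = 0..lie_rank L.
        of_nat (num_subalgebras (residue_ring (int p)) (Fp_points L p) (p ^ i)) * (of_nat p powr (- s)) ^ i)"

end

theory Submission
  imports Defs
begin

text \<open>
  Reducing coordinates modulo \<open>p\<close> identifies the extension of scalars with the Heisenberg algebra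
  on triples over \<open>\<int>/p\<close>: the kernel of \<open>x \<otimes> a \<mapsto> a x\<close> modulo \<open>p\<close> is exactly the subgroup of
  biadditivity relations, because every formal sum of pure tensors can be rewritten as
  \<open>\<Sum> x\<^sub>k \<otimes> c\<^sub>k\<close>. By Lagrange, counting by index is counting by cardinality. Every line is a
  subalgebra, giving the \<open>1 + p + p\<^sup>2\<close> points of the projective plane; a nonzero ideal, or a
  two-dimensional subalgebra, must contain the centre, so that the planes in question correspond
  to the \<open>1 + p\<close> lines modulo the centre, and the centre is the only one-dimensional ideal.
\<close>

section \<open>Isomorphisms of Lie algebras and counting\<close>

text \<open>For the converse direction the inverse isomorphism carries the image of \<open>M\<close>
  back to \<open>M\<close>.\<close>

lemma subgroup_image_iff:
  assumes "group G" "group H" and h: "h \<in> iso G H" and M: "M \<subseteq> carrier G"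
  shows "subgroup (h ` M) H \<longleftrightarrow> subgroup M G"
proof
  interpret group_hom G H h
    using assms by (simp add: group_hom_def group_hom_axioms_def iso_def)
  show "subgroup M G \<Longrightarrow> subgroup (h ` M) H"
    by (rule subgroup_img_is_subgroup)
  assume sub: "subgroup (h ` M) H"
  let ?k = "inv_into (carrier G) h"
  have k: "?k \<in> iso H G" by (rule G.iso_set_sym[OF h])
  interpret K: group_hom H G ?k
    using assms k by (simp add: group_hom_def group_hom_axioms_def iso_def)
  have "?k ` h ` M = M"
    using h M by (intro inv_into_image_cancel) (auto simp: iso_def bij_betw_def)
  then show "subgroup M G"
    using K.subgroup_img_is_subgroup[OF sub] by simp
qed

text \<open>A bijection compatible with sums, scalars and brackets transports subalgebras and
  ideals. The closure and finiteness assumptions concern \<open>L\<close>, which is to be the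
  explicit model; \<open>L'\<close> is to be the tensor product, whose operations are known only
  through \<open>h\<close>.\<close>

locale lie_iso =
  fixes R :: "('a, 'm) ring_scheme" and L :: "('a, 'b, 'n) lie_algebra_scheme"
    and L' :: "('a, 'c, 'k) lie_algebra_scheme" and h :: "'b \<Rightarrow> 'c"
  assumes group_L: "group (add_monoid L)" and group_L': "group (add_monoid L')"
    and iso: "h \<in> iso (add_monoid L) (add_monoid L')"
    and smult_carrier:
      "\<lbrakk>a \<in> carrier R; x \<in> carrier L\<rbrakk> \<Longrightarrow> a \<odot>\<^bsub>L\<^esub> x \<in> carrier L"
    and smult_hom:
      "\<lbrakk>a \<in> carrier R; x \<in> carrier L\<rbrakk> \<Longrightarrow> h (a \<odot>\<^bsub>L\<^esub> x) = a \<odot>\<^bsub>L'\<^esub> h x"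
    and bracket_carrier:
      "\<lbrakk>x \<in> carrier L; y \<in> carrier L\<rbrakk> \<Longrightarrow> lie_bracket L x y \<in> carrier L"
    and bracket_hom:
      "\<lbrakk>x \<in> carrier L; y \<in> carrier L\<rbrakk> \<Longrightarrow>
        h (lie_bracket L x y) = lie_bracket L' (h x) (h y)"
    and finite_carrier: "finite (carrier L)"
begin

lemma inj: "inj_on h (carrier L)" and surj: "h ` carrier L = carrier L'"
  using iso by (auto simp: iso_def bij_betw_def)

lemma mem_image_iff: "\<lbrakk>M \<subseteq> carrier L; x \<in> carrier L\<rbrakk> \<Longrightarrow> h x \<in> h ` M \<longleftrightarrow> x \<in> M"
  using inj by (rule inj_on_image_mem_iff)

lemma submodule_image_iff:
  assumes M: "M \<subseteq> carrier L"
  shows "submodule (h ` M) R L' \<longleftrightarrow> submodule M R L"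
proof -
  have "a \<odot>\<^bsub>L'\<^esub> h x \<in> h ` M \<longleftrightarrow> a \<odot>\<^bsub>L\<^esub> x \<in> M" if "a \<in> carrier R" "x \<in> M" for a x
    using that M mem_image_iff[OF M smult_carrier[of a x]] smult_hom[of a x] by auto
  moreover have "subgroup (h ` M) (add_monoid L') \<longleftrightarrow> subgroup M (add_monoid L)"
    using M by (intro subgroup_image_iff group_L group_L' iso) simp
  ultimately show ?thesis
    unfolding submodule_def submodule_axioms_def by auto
qed

lemma bracket_mem_image_iff:
  assumes "M \<subseteq> carrier L" "x \<in> carrier L" "y \<in> carrier L"
  shows "lie_bracket L' (h x) (h y) \<in> h ` M \<longleftrightarrow> lie_bracket L x y \<in> M"
  using assms mem_image_iff[of M "lie_bracket L x y"] bracket_carrier bracket_hom by simp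

lemma lie_subalgebra_image_iff:
  "M \<subseteq> carrier L \<Longrightarrow> lie_subalgebra (h ` M) R L' \<longleftrightarrow> lie_subalgebra M R L"
  unfolding lie_subalgebra_def
  by (simp add: submodule_image_iff bracket_mem_image_iff subset_iff)

lemma lie_ideal_image_iff:
  "M \<subseteq> carrier L \<Longrightarrow> lie_ideal (h ` M) R L' \<longleftrightarrow> lie_ideal M R L"
  unfolding lie_ideal_def surj[symmetric]
  by (simp add: submodule_image_iff bracket_mem_image_iff subset_iff)

text \<open>Lagrange's theorem in \<open>L'\<close>: index times cardinality is the order
  \<open>m * k\<close>, so either factor determines the other.\<close>

lemma index_image_iff:
  assumes M: "submodule M R L" and k: "m * k = card (carrier L)" "k > 0"
  shows "card (a_rcosets\<^bsub>L'\<^esub> (h ` M)) = m \<longleftrightarrow> card M = k"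
proof -
  have sub: "M \<subseteq> carrier L"
    using submodule.axioms(1)[OF M] subgroup.subset by fastforce
  have "submodule (h ` M) R L'" using M sub by (simp add: submodule_image_iff)
  then have "subgroup (h ` M) (add_monoid L')" by (rule submodule.axioms)
  from group.lagrange[OF group_L' this]
  have "card (a_rcosets\<^bsub>L'\<^esub> (h ` M)) * card (h ` M) = card (carrier L')"
    by (simp add: A_RCOSETS_def order_def)
  moreover have "card (carrier L') = card (carrier L)"
    using inj surj card_image by fastforce
  moreover have "card (h ` M) = card M"
    using inj sub by (meson card_image inj_on_subset)
  ultimately have *: "card (a_rcosets\<^bsub>L'\<^esub> (h ` M)) * card M = m * k" using k by simp
  \<comment> \<open>The carrier is finite and nonempty, hence \<open>m * k\<close> is nonzero and
    \<open>m\<close> can be cancelled.\<close>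
  have "\<zero>\<^bsub>L\<^esub> \<in> carrier L"
    using monoid.one_closed[OF group.is_monoid[OF group_L]] by simp
  then have "m > 0" using k finite_carrier card_gt_0_iff[of "carrier L"] by auto
  show ?thesis
  proof
    assume "card (a_rcosets\<^bsub>L'\<^esub> (h ` M)) = m"
    with * \<open>m > 0\<close> show "card M = k" by (metis mult_left_cancel less_irrefl)
  next
    assume "card M = k"
    with * \<open>k > 0\<close> show "card (a_rcosets\<^bsub>L'\<^esub> (h ` M)) = m" by simp
  qed
qed

text \<open>Taking direct images is a bijection between the two families: onto because
  \<open>h\<close> is onto, injective because \<open>h\<close> is. \<open>P\<close> and
  \<open>P'\<close> stand for the same property, subalgebra or ideal, on the two sides.\<close>

lemma count_transfer:
  assumes sub': "\<And>M. P' M \<Longrightarrow> M \<subseteq> carrier L'"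
    and sub: "\<And>M. P M \<Longrightarrow> submodule M R L"
    and iff: "\<And>M. M \<subseteq> carrier L \<Longrightarrow> P' (h ` M) \<longleftrightarrow> P M"
    and k: "m * k = card (carrier L)" "k > 0"
  shows "card {M. P' M \<and> card (a_rcosets\<^bsub>L'\<^esub> M) = m} = card {M. P M \<and> card M = k}"
proof -
  have PL: "M \<subseteq> carrier L" if "P M" for M
    using submodule.axioms(1)[OF sub[OF that]] subgroup.subset by fastforce
  have "{M. P' M \<and> card (a_rcosets\<^bsub>L'\<^esub> M) = m} = (`) h ` {M. P M \<and> card M = k}"
  proof (intro equalityI subsetI)
    fix N assume N: "N \<in> {M. P' M \<and> card (a_rcosets\<^bsub>L'\<^esub> M) = m}"
    then obtain M where M: "M \<subseteq> carrier L" "N = h ` M"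
      using sub' surj by (metis (lifting) mem_Collect_eq subset_imageE)
    with N have "P M" using iff by blast
    then show "N \<in> (`) h ` {M. P M \<and> card M = k}"
      using N M index_image_iff[OF sub k] by blast
  next
    fix N assume "N \<in> (`) h ` {M. P M \<and> card M = k}"
    then show "N \<in> {M. P' M \<and> card (a_rcosets\<^bsub>L'\<^esub> M) = m}"
      using iff[OF PL] index_image_iff[OF sub k] by blast
  qed
  moreover have "inj_on ((`) h) {M. P M \<and> card M = k}"
    by (rule inj_on_subset[OF inj_on_image_Pow[OF inj]]) (use PL in auto)
  ultimately show ?thesis by (simp add: card_image)
qed

lemma submodule_subset: "submodule M R L' \<Longrightarrow> M \<subseteq> carrier L'"
  using subgroup.subset[OF submodule.axioms(1)] by fastforce

lemma num_subalgebras_eq: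
  assumes "m * k = card (carrier L)" "k > 0"
  shows "num_subalgebras R L' m = card {M. lie_subalgebra M R L \<and> card M = k}"
  unfolding num_subalgebras_def using assms
  by (intro count_transfer lie_subalgebra_image_iff)
     (auto simp: lie_subalgebra_def dest: submodule_subset)

lemma num_ideals_eq:
  assumes "m * k = card (carrier L)" "k > 0"
  shows "num_ideals R L' m = card {M. lie_ideal M R L \<and> card M = k}"
  unfolding num_ideals_def using assms
  by (intro count_transfer lie_ideal_image_iff)
     (auto simp: lie_ideal_def dest: submodule_subset)

end

section \<open>The Heisenberg algebra on triples of residues\<close>

text \<open>Triples are coordinates with respect to the basis, kept as reduced residues. The scalar
  in \<open>smult\<close> may be any integer, so that \<open>-1\<close> can be used
  directly.\<close>

definition heis_mod :: "int \<Rightarrow> (int, int \<times> int \<times> int) lie_algebra" where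
  "heis_mod p =
     \<lparr>carrier = {0..<p} \<times> {0..<p} \<times> {0..<p}, monoid.mult = undefined, one = undefined,
      ring.zero = (0, 0, 0),
      ring.add = (\<lambda>(x, y, z) (x', y', z'). ((x + x') mod p, (y + y') mod p, (z + z') mod p)),
      smult = (\<lambda>c (x, y, z). (c * x mod p, c * y mod p, c * z mod p)),
      lie_bracket = (\<lambda>(x, y, z) (x', y', z'). (0, 0, (x * y' - y * x') mod p))\<rparr>"

text \<open>Linear combinations of two vectors with arbitrary integer coefficients; closure under
  \<open>comb\<close> will express both submodule conditions at once.\<close>

fun comb :: "int \<Rightarrow> int \<Rightarrow> int \<times> int \<times> int \<Rightarrow> int \<Rightarrow> int \<times> int \<times> int \<Rightarrow> int \<times> int \<times> int" where
  "comb p a (x, y, z) b (x', y', z') =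
     ((a * x + b * x') mod p, (a * y + b * y') mod p, (a * z + b * z') mod p)"

lemma mod_comb_left: "(a mod m * x + b mod m * y) mod m = (a * x + b * y) mod (m::int)"
  by (metis mod_add_eq mod_mult_left_eq)

lemma mod_comb_right: "(a * (x mod m) + b * (y mod m)) mod m = (a * x + b * y) mod (m::int)"
  by (metis mod_add_eq mod_mult_right_eq)

lemma mod_minor:
  "(a mod m * (b mod m) - c mod m * (d mod m)) mod m = (a * b - c * d) mod (m::int)"
  by (metis mod_diff_eq mod_mult_eq)

locale heis_residues =
  fixes p :: int
  assumes prime_p: "prime p"
begin

abbreviation A where "A \<equiv> heis_mod p"
abbreviation Fp where "Fp \<equiv> residue_ring p"
abbreviation V where "V \<equiv> {0..<p} \<times> {0..<p} \<times> {0..<p}"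

lemma p_gt_1: "p > 1"
  using prime_p by (rule prime_gt_1_int)

lemma p_pos: "p > 0"
  using p_gt_1 by simp

lemma carrier_A: "carrier A = V"
  by (simp add: heis_mod_def)

lemma card_V: "card (carrier A) = nat p ^ 3"
  by (simp add: carrier_A card_cartesian_product power3_eq_cube)

lemma finite_A: "finite (carrier A)"
  by (simp add: carrier_A)

lemma group_A: "group (add_monoid A)"
proof (rule groupI)
  fix u assume "u \<in> carrier (add_monoid A)"
  then obtain x y z where u: "u = (x, y, z)" "(x, y, z) \<in> V" by (cases u) (auto simp: heis_mod_def)
  then show "\<exists>v\<in>carrier (add_monoid A). v \<otimes>\<^bsub>add_monoid A\<^esub> u = \<one>\<^bsub>add_monoid A\<^esub>"
    using p_pos by (intro bexI[of _ "(- x mod p, - y mod p, - z mod p)"])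
      (auto simp: heis_mod_def mod_add_left_eq)
qed (use p_pos in \<open>auto simp: heis_mod_def mod_add_left_eq mod_add_right_eq ac_simps\<close>)

text \<open>Forwards, each coefficient acts through its residue, which is a scalar of
  \<open>Fp\<close>. Backwards, coefficients \<open>1, 1\<close> give sums and coefficients
  \<open>a, 0\<close> give multiples, with \<open>a = -1\<close> giving inverses.\<close>

lemma submodule_iff:
  "submodule N Fp A \<longleftrightarrow>
     N \<subseteq> V \<and> N \<noteq> {} \<and> (\<forall>u\<in>N. \<forall>v\<in>N. \<forall>a b. comb p a u b v \<in> N)"
proof
  assume N: "submodule N Fp A"
  interpret submodule N Fp A by (rule N)
  have sub: "N \<subseteq> V" using subset by (simp add: carrier_A)
  have sm: "(a * x mod p, a * y mod p, a * z mod p) \<in> N" if "(x, y, z) \<in> N" for a x y z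
    using smult_closed[of "a mod p" "(x, y, z)"] that p_pos
    by (simp add: heis_mod_def residue_ring_def mod_mult_left_eq)
  have ad: "((x + x') mod p, (y + y') mod p, (z + z') mod p) \<in> N"
    if "(x, y, z) \<in> N" "(x', y', z') \<in> N" for x y z x' y' z'
    using m_closed[OF that] by (simp add: heis_mod_def)
  have "comb p a u b v \<in> N" if "u \<in> N" "v \<in> N" for a b u v
    using that ad[OF sm[of _ _ _ a] sm[of _ _ _ b]]
    by (cases u; cases v) (auto simp: mod_add_eq)
  moreover have "N \<noteq> {}" using one_closed by blast
  ultimately show "N \<subseteq> V \<and> N \<noteq> {} \<and> (\<forall>u\<in>N. \<forall>v\<in>N. \<forall>a b. comb p a u b v \<in> N)"
    using sub by blast
next
  assume "N \<subseteq> V \<and> N \<noteq> {} \<and> (\<forall>u\<in>N. \<forall>v\<in>N. \<forall>a b. comb p a u b v \<in> N)"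
  then have sub: "N \<subseteq> V" and ne: "N \<noteq> {}"
    and c: "\<And>u v a b. \<lbrakk>u \<in> N; v \<in> N\<rbrakk> \<Longrightarrow> comb p a u b v \<in> N" by auto
  interpret G: group "add_monoid A" by (rule group_A)
  have sm: "a \<odot>\<^bsub>A\<^esub> u \<in> N" if "u \<in> N" for a u
    using c[OF that that, of a 0] by (cases u) (simp add: heis_mod_def)
  have "subgroup N (add_monoid A)"
  proof (rule G.subgroupI)
    fix u assume u: "u \<in> N"
    have "(-1) \<odot>\<^bsub>A\<^esub> u \<otimes>\<^bsub>add_monoid A\<^esub> u = \<one>\<^bsub>add_monoid A\<^esub>"
      by (cases u) (simp add: heis_mod_def mod_add_left_eq)
    then have "inv\<^bsub>add_monoid A\<^esub> u = (-1) \<odot>\<^bsub>A\<^esub> u"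
      using u sub sm[OF u, of "-1"] by (intro G.inv_equality) (auto simp: heis_mod_def)
    then show "inv\<^bsub>add_monoid A\<^esub> u \<in> N" using sm[OF u] by simp
  next
    fix u v assume "u \<in> N" "v \<in> N"
    then show "u \<otimes>\<^bsub>add_monoid A\<^esub> v \<in> N"
      using c[of u v 1 1] by (cases u; cases v) (simp add: heis_mod_def)
  qed (use sub ne in \<open>simp_all add: carrier_A\<close>)
  then show "submodule N Fp A"
    using sm by (simp add: submodule_def submodule_axioms_def)
qed

lemma submoduleD:
  assumes "submodule N Fp A"
  shows "N \<subseteq> V" "finite N" "(0, 0, 0) \<in> N"
    "\<And>u v a b. \<lbrakk>u \<in> N; v \<in> N\<rbrakk> \<Longrightarrow> comb p a u b v \<in> N"
proof -
  show sub: "N \<subseteq> V" and c: "\<And>u v a b. \<lbrakk>u \<in> N; v \<in> N\<rbrakk> \<Longrightarrow> comb p a u b v \<in> N"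
    using assms by (simp_all add: submodule_iff)
  show "finite N" using sub by (rule finite_subset) simp
  obtain x y z where "(x, y, z) \<in> N" using assms by (auto simp: submodule_iff)
  then show "(0, 0, 0) \<in> N" using c[of "(x, y, z)" "(x, y, z)" 0 0] by simp
qed

lemma lie_ideal_imp_subalgebra: "lie_ideal N Fp A \<Longrightarrow> lie_subalgebra N Fp A"
  using submoduleD(1) unfolding lie_ideal_def lie_subalgebra_def carrier_A by blast

section \<open>Lines, planes through the centre, and their normalised directions\<close>

lemma exists_inverse:
  assumes "0 < x" "x < p"
  obtains c where "c * x mod p = 1"
proof -
  have "\<not> p dvd x" using assms zdvd_not_zless by blast
  then have "coprime x p"
    using prime_p by (simp add: coprime_commute prime_imp_coprime)
  then obtain c where "[x * c = 1] (mod p)" using cong_solve_coprime_int by blast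
  then show thesis using that[of c] p_gt_1 by (simp add: cong_def mult.commute)
qed

text \<open>The span of \<open>w\<close>. The second coefficient 0 makes \<open>comb\<close> a mere
  scaling, so closure facts about \<open>comb\<close> apply directly.\<close>

definition line where "line w = (\<lambda>a. comb p a w 0 w) ` {0..<p}"
text \<open>The span of \<open>w\<close> and the generator \<open>(0, 0, 1)\<close> of the
  centre.\<close>

definition plane where "plane w = (\<lambda>(a, c). comb p a w c (0, 0, 1)) ` ({0..<p} \<times> {0..<p})"

text \<open>Normalised representatives of the points of the projective plane: the first nonzero
  coordinate is 1. \<open>plane_dirs\<close> does the same for directions modulo the centre.\<close>

definition line_dirs :: "(int \<times> int \<times> int) set" where
  "line_dirs = (\<lambda>(y, z). (1, y, z)) ` ({0..<p} \<times> {0..<p}) \<union> (\<lambda>z. (0, 1, z)) ` {0..<p} \<union> {(0, 0, 1)}"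
definition plane_dirs :: "(int \<times> int \<times> int) set" where
  "plane_dirs = (\<lambda>y. (1, y, 0)) ` {0..<p} \<union> {(0, 1, 0)}"

lemma card_line_dirs: "card line_dirs = 1 + nat p + nat p ^ 2"
proof -
  have "card ((\<lambda>(y, z). (1::int, y, z)) ` ({0..<p} \<times> {0..<p})) = nat p ^ 2"
    by (subst card_image) (auto simp: inj_on_def power2_eq_square)
  moreover have "card ((\<lambda>z. (0::int, 1::int, z)) ` {0..<p}) = nat p"
    by (subst card_image) (auto simp: inj_on_def)
  ultimately show ?thesis
    unfolding line_dirs_def by (subst card_Un_disjoint; (subst card_Un_disjoint)?) auto
qed

lemma card_plane_dirs: "card plane_dirs = 1 + nat p"
proof -
  have "card ((\<lambda>y. (1::int, y, 0::int)) ` {0..<p}) = nat p"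
    by (subst card_image) (auto simp: inj_on_def)
  then show ?thesis unfolding plane_dirs_def by (subst card_Un_disjoint) auto
qed

lemma line_dirs_V: "line_dirs \<subseteq> V" and plane_dirs_V: "plane_dirs \<subseteq> V"
  using p_gt_1 by (auto simp: line_dirs_def plane_dirs_def)

text \<open>Coefficients matter only modulo \<open>p\<close>, so any integer may replace one from
  \<open>{0..<p}\<close>.\<close>

lemma line_memI: "comb p a w 0 w \<in> line w"
proof -
  have "comb p a w 0 w = comb p (a mod p) w 0 w"
    by (cases w) (simp add: mod_mult_left_eq)
  then show ?thesis using p_pos by (auto simp: line_def)
qed

lemma plane_memI: "comb p a w c (0, 0, 1) \<in> plane w"
proof -
  have "comb p a w c (0, 0, 1) = comb p (a mod p) w (c mod p) (0, 0, 1)"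
    by (cases w) (simp only: comb.simps mod_comb_left)
  then show ?thesis using p_pos by (auto simp: plane_def intro!: image_eqI[of _ _ "(a mod p, c mod p)"])
qed

lemma comb_V: "comb p a u b v \<in> V"
  using p_pos by (cases u; cases v) simp

lemma submodule_line: "submodule (line w) Fp A"
proof -
  have comb: "comb p a (comb p c w 0 w) b (comb p d w 0 w) = comb p (a * c + b * d) w 0 w" for a b c d
    by (cases w) (simp add: mod_comb_right algebra_simps)
  show ?thesis
    unfolding submodule_iff
  proof (intro conjI ballI allI)
    show "line w \<subseteq> V" unfolding line_def using comb_V by blast
    show "line w \<noteq> {}" using line_memI by blast
    fix u v a b
    assume "u \<in> line w" "v \<in> line w"
    then obtain c d where "u = comb p c w 0 w" "v = comb p d w 0 w" unfolding line_def by blast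
    then show "comb p a u b v \<in> line w" by (simp only: comb line_memI)
  qed
qed

lemma submodule_plane: "submodule (plane w) Fp A"
proof -
  have comb: "comb p a (comb p c w d (0, 0, 1)) b (comb p c' w d' (0, 0, 1))
      = comb p (a * c + b * c') w (a * d + b * d') (0, 0, 1)" for a b c d c' d'
    by (cases w) (simp add: mod_comb_right algebra_simps)
  show ?thesis
    unfolding submodule_iff
  proof (intro conjI ballI allI)
    show "plane w \<subseteq> V"
      unfolding plane_def by (rule image_subsetI) (simp only: case_prod_unfold comb_V)
    show "plane w \<noteq> {}" using plane_memI by blast
    fix u v a b
    assume "u \<in> plane w" "v \<in> plane w"
    then obtain c d c' d' where "u = comb p c w d (0, 0, 1)" "v = comb p c' w d' (0, 0, 1)"
      by (auto simp: plane_def simp del: comb.simps)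
    then show "comb p a u b v \<in> plane w" by (simp only: comb plane_memI)
  qed
qed

text \<open>Some coordinate of a normalised vector is 1, and in that place a multiple shows its
  coefficient.\<close>

lemma card_line:
  assumes "w \<in> line_dirs"
  shows "card (line w) = nat p"
proof -
  have "inj_on (\<lambda>a. comb p a w 0 w) {0..<p}"
    using assms by (auto simp: line_dirs_def inj_on_def)
  then show ?thesis unfolding line_def by (simp add: card_image)
qed

text \<open>The coordinate 1 of \<open>w\<close> reveals the first coefficient; the last coordinate
  of \<open>w\<close> is 0, so there the second coefficient appears unchanged.\<close>

lemma card_plane:
  assumes "w \<in> plane_dirs"
  shows "card (plane w) = nat p ^ 2"
proof -
  have "inj_on (\<lambda>(a, c). comb p a w c (0, 0, 1)) ({0..<p} \<times> {0..<p})"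
    using assms by (auto simp: plane_dirs_def inj_on_def)
  then show ?thesis unfolding plane_def by (simp add: card_image power2_eq_square)
qed

lemma mem_line: "w \<in> V \<Longrightarrow> w \<in> line w"
  using line_memI[of 1 w] by (cases w) simp

text \<open>If one normalised vector is a multiple of another, their leading ones stand in the same
  place and force the coefficient to be 1.\<close>

lemma inj_on_line: "inj_on line line_dirs"
proof (rule inj_onI)
  fix w w' assume w: "w \<in> line_dirs" "w' \<in> line_dirs" and eq: "line w = line w'"
  have "w \<in> line w'" using mem_line w line_dirs_V eq by blast
  then obtain a where "0 \<le> a" "a < p" "w = comb p a w' 0 w'" by (auto simp: line_def)
  with w show "w = w'" by (auto simp: line_dirs_def)
qed

lemma inj_on_plane: "inj_on plane plane_dirs"
proof (rule inj_onI)
  fix w w' assume w: "w \<in> plane_dirs" "w' \<in> plane_dirs" and eq: "plane w = plane w'"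
  have "w \<in> plane w" using plane_memI[of 1 w 0] w plane_dirs_V by (cases w) auto
  then obtain a c where "0 \<le> a" "a < p" "w = comb p a w' c (0, 0, 1)"
    unfolding eq by (auto simp: plane_def simp del: comb.simps)
  with w show "w = w'" by (auto simp: plane_dirs_def)
qed

lemma line_subset: "\<lbrakk>submodule N Fp A; w \<in> N\<rbrakk> \<Longrightarrow> line w \<subseteq> N"
  by (auto simp: line_def simp del: comb.simps intro: submoduleD(4))

lemma plane_subset: "\<lbrakk>submodule N Fp A; w \<in> N; (0, 0, 1) \<in> N\<rbrakk> \<Longrightarrow> plane w \<subseteq> N"
  by (auto simp: plane_def simp del: comb.simps intro: submoduleD(4))

text \<open>The scalar is the inverse modulo \<open>p\<close> of the first nonzero coordinate; the
  three cases are its possible positions.\<close>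

lemma normalise:
  assumes N: "submodule N Fp A" and u: "u \<in> N" "u \<noteq> (0, 0, 0)"
  obtains c where "comb p c u 0 u \<in> line_dirs" "comb p c u 0 u \<in> N"
proof -
  obtain x y z where xyz: "u = (x, y, z)" by (cases u)
  have "(x, y, z) \<in> V" using u(1) submoduleD(1)[OF N] unfolding xyz by (rule rev_subsetD)
  then have V: "x \<in> {0..<p}" "y \<in> {0..<p}" "z \<in> {0..<p}" by simp_all
  consider "x > 0" | "x = 0" "y > 0" | "x = 0" "y = 0" "z > 0"
    using u xyz V by fastforce
  then have "\<exists>c. comb p c u 0 u \<in> line_dirs"
  proof cases
    case 1
    then obtain c where c: "c * x mod p = 1" using exists_inverse V(1) by auto
    have "comb p c u 0 u \<in> (\<lambda>(y, z). (1, y, z)) ` ({0..<p} \<times> {0..<p})"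
      using c p_pos by (intro image_eqI[of _ _ "(c * y mod p, c * z mod p)"]) (auto simp: xyz)
    then show ?thesis unfolding line_dirs_def by blast
  next
    case 2
    then obtain c where c: "c * y mod p = 1" using exists_inverse V(2) by auto
    have "comb p c u 0 u \<in> (\<lambda>z. (0, 1, z)) ` {0..<p}"
      using c p_pos 2 by (intro image_eqI[of _ _ "c * z mod p"]) (auto simp: xyz)
    then show ?thesis unfolding line_dirs_def by blast
  next
    case 3
    then obtain c where c: "c * z mod p = 1" using exists_inverse V(3) by auto
    have "comb p c u 0 u = (0, 0, 1)" using c 3 by (simp add: xyz)
    then show ?thesis unfolding line_dirs_def by auto
  qed
  then show thesis using that submoduleD(4)[OF N u(1) u(1)] by blast
qed

text \<open>Since \<open>p > 1\<close> there is a nonzero vector; the line through it lies in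
  \<open>N\<close> and already has as many elements.\<close>

lemma submodule_card_p:
  assumes N: "submodule N Fp A" and card: "card N = nat p"
  shows "N \<in> line ` line_dirs"
proof -
  have "card N > card {(0::int, 0::int, 0::int)}" using card p_gt_1 by simp
  then have "\<not> N \<subseteq> {(0, 0, 0)}" by (meson card_mono finite.emptyI finite.insertI not_le)
  then obtain u where "u \<in> N" "u \<noteq> (0, 0, 0)" by blast
  from normalise[OF N this] obtain w where w: "w \<in> line_dirs" "w \<in> N" by blast
  have "line w = N"
    using card_line[OF w(1)] card by (intro card_subset_eq submoduleD(2)[OF N] line_subset N w) auto
  then show ?thesis using w by blast
qed

lemma central_mem_of_smult:
  assumes N: "submodule N Fp A" and z: "(0, 0, z) \<in> N" "z \<noteq> 0"
  shows "(0, 0, 1) \<in> N"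
proof -
  have "0 < z" "z < p" using submoduleD(1)[OF N] z by auto
  then obtain c where "c * z mod p = 1" by (rule exists_inverse)
  then show ?thesis using submoduleD(4)[OF N z(1) z(1), of c 0] by simp
qed

lemma submodule_card_p2:
  assumes N: "submodule N Fp A" and card: "card N = nat p ^ 2" and z: "(0, 0, 1) \<in> N"
  shows "N \<in> plane ` plane_dirs"
proof -
  have "(0, 0, 1) \<in> line_dirs" by (simp add: line_dirs_def)
  from card_line[OF this] have c: "card (line (0, 0, 1)) = nat p" .
  \<comment> \<open>By size, \<open>N\<close> is larger than the centre, so it has a vector outside
    it.\<close>
  have "nat p < nat p ^ 2" using p_gt_1 by (simp add: power2_eq_square)
  then have "\<not> N \<subseteq> line (0, 0, 1)"
    using card_mono[OF submoduleD(2)[OF submodule_line], of N "(0, 0, 1)"] c card by linarith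
  then obtain x y z' where u: "(x, y, z') \<in> N" "(x, y, z') \<notin> line (0, 0, 1)" by auto
  \<comment> \<open>Adding \<open>- z'\<close> times the central vector clears the last
    coordinate.\<close>
  have v: "(x, y, 0) \<in> N"
    using submoduleD(4)[OF N u(1) z, of 1 "- z'"] submoduleD(1)[OF N] u(1) by auto
  have "(x, y, 0::int) \<noteq> (0, 0, 0)"
  proof
    assume "(x, y, 0::int) = (0, 0, 0)"
    then show False
      using u line_memI[of z' "(0, 0, 1)"] submoduleD(1)[OF N] by auto
  qed
  from normalise[OF N v this] obtain k where w: "comb p k (x, y, 0) 0 (x, y, 0) \<in> line_dirs"
    "comb p k (x, y, 0) 0 (x, y, 0) \<in> N" by blast
  define w where "w = comb p k (x, y, 0) 0 (x, y, 0)"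
  \<comment> \<open>Scaling keeps the last coordinate 0, which leaves exactly those normalised
    vectors that are directions modulo the centre.\<close>
  have wp: "w \<in> plane_dirs" and wN: "w \<in> N"
    using w by (auto simp: w_def line_dirs_def plane_dirs_def)
  have "plane w = N"
    using card_plane[OF wp] card
    by (intro card_subset_eq submoduleD(2)[OF N] plane_subset N wN z) auto
  then show ?thesis using wp by blast
qed

section \<open>Brackets, ideals and the role of the centre\<close>

lemma bracket_A: "lie_bracket A (x, y, z) (x', y', z') = (0, 0, (x * y' - y * x') mod p)"
  by (simp add: heis_mod_def)

text \<open>Two multiples of one vector have vanishing 2 by 2 minor, so the bracket is zero on a
  line.\<close>

lemma lie_subalgebra_line: "lie_subalgebra (line w) Fp A"
proof -
  have "lie_bracket A (comb p a w 0 w) (comb p b w 0 w) = (0, 0, 0)" for a b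
  proof -
    obtain x y z where w: "w = (x, y, z)" by (cases w)
    have "(a * x mod p * (b * y mod p) - a * y mod p * (b * x mod p)) mod p
        = (a * x * (b * y) - a * y * (b * x)) mod p" by (rule mod_minor)
    then show ?thesis by (simp add: w bracket_A algebra_simps)
  qed
  then show ?thesis
    using submodule_line[of w] submoduleD(3)[OF submodule_line, of w]
    by (auto simp: lie_subalgebra_def line_def simp del: comb.simps)
qed

lemma bracket_central: obtains c where "lie_bracket A u v = (0, 0, c mod p)"
  by (cases u; cases v) (auto simp: bracket_A)

text \<open>Every bracket is a multiple of \<open>(0, 0, 1)\<close>.\<close>

lemma lie_ideal_of_central:
  assumes N: "submodule N Fp A" and z: "(0, 0, 1) \<in> N"
  shows "lie_ideal N Fp A"
  unfolding lie_ideal_def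
proof (intro conjI N ballI)
  fix u v
  obtain c where "lie_bracket A u v = (0, 0, c mod p)" by (rule bracket_central)
  then show "lie_bracket A u v \<in> N" using submoduleD(4)[OF N z z, of c 0] by simp
qed

lemma central_mem_plane: "(0, 0, 1) \<in> plane w"
  using plane_memI[of 0 w 1] p_gt_1 by (cases w) simp

text \<open>Two vectors of a subalgebra avoiding the centre commute, and its projection to the first two
  coordinates is injective; by cardinality the projection is onto, so some pair does not
  commute.\<close>

lemma subalgebra_card_p2_central:
  assumes N: "lie_subalgebra N Fp A" and card: "card N = nat p ^ 2"
  shows "(0, 0, 1) \<in> N"
proof (rule ccontr)
  assume no: "(0, 0, 1) \<notin> N"
  have S: "submodule N Fp A" using N by (simp add: lie_subalgebra_def)
  have z: "z = 0" if "(0, 0, z) \<in> N" for z using central_mem_of_smult[OF S that] no by blast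
  define \<pi> :: "int \<times> int \<times> int \<Rightarrow> int \<times> int" where "\<pi> = (\<lambda>(x, y, z). (x, y))"
  have "inj_on \<pi> N"
  proof (rule inj_onI)
    fix u v assume uv: "u \<in> N" "v \<in> N" "\<pi> u = \<pi> v"
    then obtain x y z z' where xy: "u = (x, y, z)" "v = (x, y, z')"
      by (cases u; cases v) (auto simp: \<pi>_def)
    have "comb p 1 u (-1) v \<in> N" using uv submoduleD(4)[OF S] by blast
    then have "(z - z') mod p = 0" using z by (simp add: xy)
    then have "z mod p = z' mod p" by (simp add: mod_eq_dvd_iff mod_eq_0_iff_dvd)
    moreover have "(x, y, z) \<in> V" "(x, y, z') \<in> V"
      using uv(1,2) submoduleD(1)[OF S] unfolding xy by blast+
    ultimately show "u = v" by (simp add: xy)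
  qed
  then have "card (\<pi> ` N) = card ({0..<p} \<times> {0..<p})"
    using card by (simp add: card_image power2_eq_square)
  moreover have "\<pi> ` N \<subseteq> {0..<p} \<times> {0..<p}"
    using submoduleD(1)[OF S] by (auto simp: \<pi>_def)
  ultimately have "\<pi> ` N = {0..<p} \<times> {0..<p}" by (intro card_subset_eq) auto
  then have "(1, 0) \<in> \<pi> ` N" "(0, 1) \<in> \<pi> ` N" using p_gt_1 by auto
  then obtain z z' where "(1, 0, z) \<in> N" "(0, 1, z') \<in> N" by (auto simp: \<pi>_def)
  then have "lie_bracket A (1, 0, z) (0, 1, z') \<in> N" using N by (simp add: lie_subalgebra_def)
  then show False using no p_gt_1 by (simp add: bracket_A)
qed

text \<open>Bracketing \<open>(x, y, z)\<close> with the first two basis vectors gives the central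
  elements with last coordinates \<open>y\<close> and \<open>-x\<close>. One of them is nonzero
  unless the vector is itself central, and a nonzero central element generates the centre.\<close>

lemma ideal_central:
  assumes N: "lie_ideal N Fp A" and card: "card N > 1"
  shows "(0, 0, 1) \<in> N"
proof -
  have S: "submodule N Fp A" using N by (simp add: lie_ideal_def)
  have br: "lie_bracket A u v \<in> N" if "u \<in> V" "v \<in> N" for u v
    using N that unfolding lie_ideal_def carrier_A by blast
  have "card N > card {(0::int, 0::int, 0::int)}" using card by simp
  then have "\<not> N \<subseteq> {(0, 0, 0)}" by (meson card_mono finite.emptyI finite.insertI not_le)
  then obtain x y z where u: "(x, y, z) \<in> N" "(x, y, z) \<noteq> (0, 0, 0)" by auto
  have "(x, y, z) \<in> V" using u(1) submoduleD(1)[OF S] by blast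
  then have xy: "0 \<le> x" "x < p" "0 \<le> y" "y < p" by simp_all
  have y: "(0, 0, y) \<in> N"
    using br[OF _ u(1), of "(1, 0, 0)"] p_gt_1 xy by (simp add: bracket_A)
  have x: "(0, 0, - x mod p) \<in> N"
    using br[OF _ u(1), of "(0, 1, 0)"] p_gt_1 by (simp add: bracket_A)
  consider "y \<noteq> 0" | "x \<noteq> 0" | "x = 0" "y = 0" by blast
  then show ?thesis
  proof cases
    case 1
    then show ?thesis using central_mem_of_smult[OF S y] by simp
  next
    case 2
    then have "- x mod p \<noteq> 0" using xy by (simp add: zmod_zminus1_eq_if)
    then show ?thesis using central_mem_of_smult[OF S x] by simp
  next
    case 3
    then show ?thesis using central_mem_of_smult[OF S] u by simp
  qed
qed

lemma lie_ideal_carrier: "lie_ideal V Fp A"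
  using p_gt_1 by (intro lie_ideal_of_central) (auto simp: submodule_iff comb_V simp del: comb.simps)

lemma lie_ideal_zero: "lie_ideal {(0, 0, 0)} Fp A"
  unfolding lie_ideal_def by (auto simp: submodule_iff bracket_A p_pos)

lemma submodule_card_1:
  assumes "submodule N Fp A" "card N = 1"
  shows "N = {(0, 0, 0)}"
  using assms submoduleD(3) by (metis card_1_singletonE singletonD)

lemma submodule_card_p3:
  assumes "submodule N Fp A" "card N = nat p ^ 3"
  shows "N = V"
  using assms submoduleD(1) card_V finite_A unfolding carrier_A by (intro card_subset_eq) auto

section \<open>Counting subalgebras and ideals by cardinality\<close>

lemma count_subalgebras:
  "card {N. lie_subalgebra N Fp A \<and> card N = nat p ^ 3} = 1"
  "card {N. lie_subalgebra N Fp A \<and> card N = nat p ^ 2} = 1 + nat p"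
  "card {N. lie_subalgebra N Fp A \<and> card N = nat p} = 1 + nat p + nat p ^ 2"
  "card {N. lie_subalgebra N Fp A \<and> card N = 1} = 1"
proof -
  have S: "submodule N Fp A" if "lie_subalgebra N Fp A" for N
    using that by (simp add: lie_subalgebra_def)
  have "{N. lie_subalgebra N Fp A \<and> card N = nat p ^ 3} = {V}"
    using submodule_card_p3 S lie_ideal_imp_subalgebra[OF lie_ideal_carrier] card_V
    unfolding carrier_A by blast
  then show "card {N. lie_subalgebra N Fp A \<and> card N = nat p ^ 3} = 1" by simp
  have "{N. lie_subalgebra N Fp A \<and> card N = nat p ^ 2} = plane ` plane_dirs"
  proof (intro equalityI subsetI)
    fix N assume "N \<in> {N. lie_subalgebra N Fp A \<and> card N = nat p ^ 2}"
    then show "N \<in> plane ` plane_dirs"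
      using submodule_card_p2[of N] subalgebra_card_p2_central[of N] S[of N] by simp
  next
    fix N assume "N \<in> plane ` plane_dirs"
    then obtain w where "w \<in> plane_dirs" "N = plane w" by blast
    then show "N \<in> {N. lie_subalgebra N Fp A \<and> card N = nat p ^ 2}"
      using card_plane[of w]
        lie_ideal_imp_subalgebra[OF lie_ideal_of_central[OF submodule_plane central_mem_plane], of w]
      by simp
  qed
  then show "card {N. lie_subalgebra N Fp A \<and> card N = nat p ^ 2} = 1 + nat p"
    by (simp add: card_image inj_on_plane card_plane_dirs)
  have "{N. lie_subalgebra N Fp A \<and> card N = nat p} = line ` line_dirs"
  proof (intro equalityI subsetI)
    fix N assume "N \<in> {N. lie_subalgebra N Fp A \<and> card N = nat p}"
    then show "N \<in> line ` line_dirs" using submodule_card_p[of N] S[of N] by simp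
  next
    fix N assume "N \<in> line ` line_dirs"
    then obtain w where "w \<in> line_dirs" "N = line w" by blast
    then show "N \<in> {N. lie_subalgebra N Fp A \<and> card N = nat p}"
      using card_line[of w] lie_subalgebra_line[of w] by simp
  qed
  then show "card {N. lie_subalgebra N Fp A \<and> card N = nat p} = 1 + nat p + nat p ^ 2"
    by (simp add: card_image inj_on_line card_line_dirs)
  have "{N. lie_subalgebra N Fp A \<and> card N = 1} = {{(0, 0, 0)}}"
    using submodule_card_1 S lie_ideal_imp_subalgebra[OF lie_ideal_zero] by auto
  then show "card {N. lie_subalgebra N Fp A \<and> card N = 1} = 1" by simp
qed

lemma count_ideals:
  "card {N. lie_ideal N Fp A \<and> card N = nat p ^ 3} = 1"
  "card {N. lie_ideal N Fp A \<and> card N = nat p ^ 2} = 1 + nat p"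
  "card {N. lie_ideal N Fp A \<and> card N = nat p} = 1"
  "card {N. lie_ideal N Fp A \<and> card N = 1} = 1"
proof -
  have S: "submodule N Fp A" if "lie_ideal N Fp A" for N
    using that by (simp add: lie_ideal_def)
  have "{N. lie_ideal N Fp A \<and> card N = nat p ^ 3} = {V}"
    using submodule_card_p3 S lie_ideal_carrier card_V unfolding carrier_A by blast
  then show "card {N. lie_ideal N Fp A \<and> card N = nat p ^ 3} = 1" by simp
  \<comment> \<open>A subalgebra of this size contains the centre and is therefore an ideal, so the
    earlier count is reused.\<close>
  have "{N. lie_ideal N Fp A \<and> card N = nat p ^ 2}
      = {N. lie_subalgebra N Fp A \<and> card N = nat p ^ 2}"
    using subalgebra_card_p2_central lie_ideal_of_central lie_ideal_imp_subalgebra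
    by (auto simp: lie_subalgebra_def)
  then show "card {N. lie_ideal N Fp A \<and> card N = nat p ^ 2} = 1 + nat p"
    by (simp add: count_subalgebras)
  have e3: "(0, 0, 1) \<in> line_dirs" by (simp add: line_dirs_def)
  then have "lie_ideal (line (0, 0, 1)) Fp A" "card (line (0, 0, 1)) = nat p"
    using line_dirs_V by (auto intro: lie_ideal_of_central[OF submodule_line] mem_line card_line)
  \<comment> \<open>A nontrivial ideal contains the centre, and here the two have the same
    size.\<close>
  moreover have "N = line (0, 0, 1)" if N: "lie_ideal N Fp A" "card N = nat p" for N
  proof -
    have "(0, 0, 1) \<in> N" using N p_gt_1 by (intro ideal_central) auto
    then show ?thesis
      using card_line[OF e3] S[OF N(1)] N(2)
      by (intro card_subset_eq[symmetric] submoduleD(2) line_subset) auto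
  qed
  ultimately have "{N. lie_ideal N Fp A \<and> card N = nat p} = {line (0, 0, 1)}" by blast
  then show "card {N. lie_ideal N Fp A \<and> card N = nat p} = 1" by simp
  have "{N. lie_ideal N Fp A \<and> card N = 1} = {{(0, 0, 0)}}"
    using submodule_card_1 S lie_ideal_zero by auto
  then show "card {N. lie_ideal N Fp A \<and> card N = 1} = 1" by simp
qed

end

section \<open>Reduction of the Heisenberg Lie ring modulo \<open>p\<close>\<close>

lemma frag_cmul_diff_right: "frag_cmul c (x - y) = frag_cmul c x - frag_cmul c y"
  by (rule poly_mapping_eqI) (simp add: lookup_minus algebra_simps)

lemma frag_extend_frag_diff:
  "frag_extend (\<lambda>i. f i - g i) w = frag_extend f w - frag_extend g w"
  by (simp add: frag_extend_def frag_cmul_diff_right sum_subtractf)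

lemma heisenberg_simps:
  "carrier heisenberg = {x. Poly_Mapping.keys x \<subseteq> {1..3}}"
  "x \<oplus>\<^bsub>heisenberg\<^esub> y = x + y"
  by (simp_all add: heisenberg_def presented_lie_ring_def free_Abelian_group_def)

lemma heisenberg_bracket:
  "lie_bracket heisenberg u v =
     frag_cmul (Poly_Mapping.lookup u 1 * Poly_Mapping.lookup v 2
       - Poly_Mapping.lookup u 2 * Poly_Mapping.lookup v 1) (frag_of 3)"
proof -
  let ?e = "frag_of 3 :: nat \<Rightarrow>\<^sub>0 int"
  \<comment> \<open>The bracket table is written as a difference of two delta functions, each of
    which \<open>frag_extend_delta\<close> evaluates.\<close>
  have "basis_bracket [(1, 2) \<mapsto> ?e] i = (\<lambda>j.
      (if j = 2 then if i = 1 then ?e else 0 else 0) - (if j = 1 then if i = 2 then ?e else 0 else 0))" for i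
    by (auto simp: basis_bracket_def fun_eq_iff)
  then have "frag_extend (basis_bracket [(1, 2) \<mapsto> ?e] i) v =
      (if i = 1 then frag_cmul (Poly_Mapping.lookup v 2) ?e else 0)
      - (if i = 2 then frag_cmul (Poly_Mapping.lookup v 1) ?e else 0)" for i
    by (simp only: frag_extend_frag_diff frag_extend_delta) simp
  then show ?thesis
    by (simp add: heisenberg_def presented_lie_ring_def frag_extend_frag_diff frag_extend_delta
      frag_cmul_diff_distrib del: One_nat_def)
qed

lemma lie_rank_heisenberg: "lie_rank heisenberg = 3"
  by (simp add: heisenberg_def lie_rank_presented)

text \<open>The map \<open>x \<otimes> a\<close> to \<open>a x\<close> on formal sums, with residues
  read as integer representatives. It kills additivity in \<open>x\<close> exactly, but additivity
  in \<open>a\<close> only modulo \<open>p\<close>; hence the reduction in \<open>coords\<close>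
  below.\<close>

definition tensor_eval :: "(('a \<Rightarrow>\<^sub>0 int) \<times> int \<Rightarrow>\<^sub>0 int) \<Rightarrow> ('a \<Rightarrow>\<^sub>0 int)" where
  "tensor_eval = frag_extend (\<lambda>(x, a). frag_cmul a x)"

lemma tensor_eval_simps [simp]:
  "tensor_eval 0 = 0"
  "tensor_eval (frag_of (x, a)) = frag_cmul a x"
  "tensor_eval (f + g) = tensor_eval f + tensor_eval g"
  "tensor_eval (f - g) = tensor_eval f - tensor_eval g"
  "tensor_eval (- f) = - tensor_eval f"
  by (simp_all add: tensor_eval_def frag_extend_add frag_extend_diff frag_extend_minus)

context heis_residues
begin

section \<open>Coordinates of formal sums and the subgroup of relations\<close>

abbreviation F where "F \<equiv> tensor_free heisenberg Fp"
abbreviation K where "K \<equiv> tensor_relations heisenberg Fp"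
abbreviation L where "L \<equiv> extend_scalars heisenberg Fp"

definition coords :: "((nat \<Rightarrow>\<^sub>0 int) \<times> int \<Rightarrow>\<^sub>0 int) \<Rightarrow> int \<times> int \<times> int" where
  "coords f = (Poly_Mapping.lookup (tensor_eval f) 1 mod p,
     Poly_Mapping.lookup (tensor_eval f) 2 mod p, Poly_Mapping.lookup (tensor_eval f) 3 mod p)"

lemma coords_V: "coords f \<in> V"
  using p_pos by (simp add: coords_def)

lemma coords_add: "coords (f + g) = coords f \<oplus>\<^bsub>A\<^esub> coords g"
  by (simp add: coords_def heis_mod_def lookup_add mod_add_eq)

lemma coords_eq_iff: "coords f = coords g \<longleftrightarrow> coords (f - g) = (0, 0, 0)"
  by (simp add: coords_def lookup_minus mod_eq_dvd_iff mod_eq_0_iff_dvd)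

lemma carrier_Fp: "carrier Fp = {0..<p}"
  by (auto simp: residue_ring_def)

lemma add_Fp: "a \<oplus>\<^bsub>Fp\<^esub> b = (a + b) mod p"
  by (simp add: residue_ring_def)

lemma carrier_F: "carrier F = {f. Poly_Mapping.keys f \<subseteq> carrier heisenberg \<times> {0..<p}}"
  by (simp add: tensor_free_def free_Abelian_group_def carrier_Fp)

lemma mult_F: "f \<otimes>\<^bsub>F\<^esub> g = f + g" and one_F: "\<one>\<^bsub>F\<^esub> = 0"
  by (simp_all add: tensor_free_def)

lemma comm_group_F: "comm_group F"
  by (simp add: tensor_free_def abelian_free_Abelian_group)

lemma inv_F: "f \<in> carrier F \<Longrightarrow> inv\<^bsub>F\<^esub> f = - f"
  by (simp add: tensor_free_def)

lemma carrier_F_closed: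
  "f \<in> carrier F \<Longrightarrow> - f \<in> carrier F"
  "\<lbrakk>f \<in> carrier F; g \<in> carrier F\<rbrakk> \<Longrightarrow> f + g \<in> carrier F"
  "\<lbrakk>f \<in> carrier F; g \<in> carrier F\<rbrakk> \<Longrightarrow> f - g \<in> carrier F"
  using keys_add[of f g] keys_diff[of f g] by (auto simp: carrier_F)

lemma frag_of_carrier_F: "frag_of (x, a) \<in> carrier F \<longleftrightarrow> x \<in> carrier heisenberg \<and> a \<in> {0..<p}"
  by (simp add: carrier_F)

lemma frag_extend_carrier_F:
  "(\<And>z. z \<in> Poly_Mapping.keys f \<Longrightarrow> h z \<in> carrier F) \<Longrightarrow> frag_extend h f \<in> carrier F"
  using keys_frag_extend[of h f] by (simp add: carrier_F) blast

text \<open>Reducing \<open>a + b\<close> changes it by a multiple of \<open>m\<close>; this is why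
  relations in the scalar factor have zero coordinates.\<close>

lemma residue_add_mod: "((a + b) mod m * x - a * x - b * x) mod m = (0::int)"
proof -
  obtain q where "(a + b) mod m = a + b - m * q"
    using mult_div_mod_eq[of m "a + b"] by (metis add_diff_cancel_left')
  then have "(a + b) mod m * x - a * x - b * x = m * (- q * x)"
    by (simp only:) (simp add: algebra_simps)
  then show ?thesis by simp
qed

text \<open>The kernel of \<open>coords\<close> is a subgroup, so only the two families of
  generators have to be checked.\<close>

lemma K_subset: "K \<subseteq> {f \<in> carrier F. coords f = (0, 0, 0)}"
proof -
  interpret F: comm_group F by (rule comm_group_F)
  have "subgroup {f \<in> carrier F. coords f = (0, 0, 0)} F"
  proof (rule F.subgroupI)
    show "{f \<in> carrier F. coords f = (0, 0, 0)} \<noteq> {}"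
      using F.one_closed by (auto simp: one_F coords_def intro!: exI[of _ 0])
  next
    fix f g assume fg: "f \<in> {f \<in> carrier F. coords f = (0, 0, 0)}" "g \<in> {f \<in> carrier F. coords f = (0, 0, 0)}"
    then show "f \<otimes>\<^bsub>F\<^esub> g \<in> {f \<in> carrier F. coords f = (0, 0, 0)}"
      by (simp add: mult_F carrier_F_closed coords_add) (simp add: heis_mod_def)
    show "inv\<^bsub>F\<^esub> f \<in> {f \<in> carrier F. coords f = (0, 0, 0)}"
      using fg(1) by (simp add: inv_F carrier_F_closed coords_def lookup_uminus zmod_zminus1_eq_if)
  qed auto
  moreover have "frag_of (x + y, a) - frag_of (x, a) - frag_of (y, a)
      \<in> {f \<in> carrier F. coords f = (0, 0, 0)}"
    if "x \<in> carrier heisenberg" "y \<in> carrier heisenberg" "a \<in> carrier Fp" for x y a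
  proof -
    have "x + y \<in> carrier heisenberg" using that keys_add[of x y] by (auto simp: heisenberg_simps)
    then show ?thesis using that
      by (auto simp: frag_of_carrier_F carrier_Fp coords_def lookup_minus lookup_add algebra_simps
          intro!: carrier_F_closed)
  qed
  moreover have "frag_of (x, (a + b) mod p) - frag_of (x, a) - frag_of (x, b)
      \<in> {f \<in> carrier F. coords f = (0, 0, 0)}"
    if "x \<in> carrier heisenberg" "a \<in> carrier Fp" "b \<in> carrier Fp" for x a b
    using that p_pos residue_add_mod
    by (auto simp: frag_of_carrier_F carrier_Fp coords_def lookup_minus
        intro!: carrier_F_closed)
  ultimately show ?thesis
    unfolding tensor_relations_def
    by (intro F.generate_subgroup_incl) (auto simp: heisenberg_simps(2) add_Fp)
qed

lemma subgroup_K: "subgroup K F"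
  unfolding tensor_relations_def
proof (rule group.generate_is_subgroup[OF comm_group.axioms(2)[OF comm_group_F]], safe)
  fix x y :: "nat \<Rightarrow>\<^sub>0 int" and a
  assume "x \<in> carrier heisenberg" "y \<in> carrier heisenberg" "a \<in> carrier Fp"
  then show "frag_of (x \<oplus>\<^bsub>heisenberg\<^esub> y, a) - frag_of (x, a) - frag_of (y, a) \<in> carrier F"
    using keys_add[of x y]
    by (intro carrier_F_closed) (auto simp: frag_of_carrier_F heisenberg_simps carrier_Fp)
next
  fix x :: "nat \<Rightarrow>\<^sub>0 int" and a b
  assume "x \<in> carrier heisenberg" "a \<in> carrier Fp" "b \<in> carrier Fp"
  then show "frag_of (x, a \<oplus>\<^bsub>Fp\<^esub> b) - frag_of (x, a) - frag_of (x, b) \<in> carrier F"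
    using p_pos by (intro carrier_F_closed) (auto simp: frag_of_carrier_F carrier_Fp add_Fp)
qed

section \<open>Normal forms modulo the relations\<close>

lemma K_closed:
  "0 \<in> K"
  "f \<in> K \<Longrightarrow> - f \<in> K"
  "\<lbrakk>f \<in> K; g \<in> K\<rbrakk> \<Longrightarrow> f + g \<in> K"
  "\<lbrakk>f \<in> K; g \<in> K\<rbrakk> \<Longrightarrow> f - g \<in> K"
proof -
  interpret subgroup K F by (rule subgroup_K)
  show "0 \<in> K" using one_closed by (simp add: one_F)
  show neg: "- f \<in> K" if "f \<in> K" for f using m_inv_closed[OF that] inv_F[of f] subset that by auto
  show add: "f + g \<in> K" if "f \<in> K" "g \<in> K" for f g using m_closed[OF that] by (simp add: mult_F)
  show "f - g \<in> K" if "f \<in> K" "g \<in> K" for f g using add[OF that(1) neg[OF that(2)]] by simp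
qed

lemma K_add_left:
  assumes "x \<in> carrier heisenberg" "y \<in> carrier heisenberg" "a \<in> {0..<p}"
  shows "frag_of (x + y, a) - frag_of (x, a) - frag_of (y, a) \<in> K"
proof -
  have "a \<in> carrier Fp" using assms by (simp add: carrier_Fp)
  then show ?thesis
    unfolding tensor_relations_def using assms
    by (intro generate.incl UnI1) (auto simp: heisenberg_simps(2))
qed

lemma K_add_right:
  assumes "x \<in> carrier heisenberg" "a \<in> {0..<p}" "b \<in> {0..<p}"
  shows "frag_of (x, (a + b) mod p) - frag_of (x, a) - frag_of (x, b) \<in> K"
proof -
  have "a \<in> carrier Fp" "b \<in> carrier Fp" using assms by (simp_all add: carrier_Fp)
  moreover have "(a + b) mod p = a \<oplus>\<^bsub>Fp\<^esub> b" by (simp add: add_Fp)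
  ultimately show ?thesis
    unfolding tensor_relations_def using assms by (intro generate.incl UnI2) auto
qed

text \<open>The reduction modulo \<open>p\<close> admits arbitrary integer coefficients and makes
  normal forms depend on residues only.\<close>

definition basis_tensor :: "nat \<Rightarrow> int \<Rightarrow> (nat \<Rightarrow>\<^sub>0 int) \<times> int \<Rightarrow>\<^sub>0 int" where
  "basis_tensor k a = frag_of (frag_of k, a mod p)"

definition normal_form :: "(nat \<Rightarrow>\<^sub>0 int) \<Rightarrow> (nat \<Rightarrow>\<^sub>0 int) \<times> int \<Rightarrow>\<^sub>0 int" where
  "normal_form v = basis_tensor 1 (Poly_Mapping.lookup v 1)
     + basis_tensor 2 (Poly_Mapping.lookup v 2) + basis_tensor 3 (Poly_Mapping.lookup v 3)"

text \<open>Additivity in the scalar for the residues of \<open>a - b\<close> and \<open>b\<close>,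
  whose sum reduces to that of \<open>a\<close>. Differences are used because
  \<open>frag_induction\<close> builds elements by differences.\<close>

lemma basis_tensor_diff:
  assumes "k \<in> {1..3}"
  shows "basis_tensor k (a - b) - (basis_tensor k a - basis_tensor k b) \<in> K"
proof -
  have "frag_of (frag_of k, ((a - b) mod p + b mod p) mod p)
      - frag_of (frag_of k, (a - b) mod p) - frag_of (frag_of k, b mod p) \<in> K"
    using assms p_pos by (intro K_add_right) (auto simp: heisenberg_simps)
  moreover have "((a - b) mod p + b mod p) mod p = a mod p" by (simp add: mod_add_eq)
  ultimately have "- (basis_tensor k a - basis_tensor k (a - b) - basis_tensor k b) \<in> K"
    by (intro K_closed(2)) (simp add: basis_tensor_def)
  then show ?thesis by (simp add: algebra_simps)
qed

lemma basis_tensor_0: "k \<in> {1..3} \<Longrightarrow> basis_tensor k 0 \<in> K"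
  using basis_tensor_diff[of k 0 0] by simp

lemma normal_form_diff: "normal_form (u - v) - (normal_form u - normal_form v) \<in> K"
proof -
  let ?d = "\<lambda>k. basis_tensor k (Poly_Mapping.lookup u k - Poly_Mapping.lookup v k)
    - (basis_tensor k (Poly_Mapping.lookup u k) - basis_tensor k (Poly_Mapping.lookup v k))"
  have "?d 1 + ?d 2 + ?d 3 \<in> K" by (intro K_closed basis_tensor_diff) auto
  then show ?thesis by (simp add: normal_form_def lookup_minus algebra_simps)
qed

lemma normal_form_0: "normal_form 0 \<in> K"
  unfolding normal_form_def by (intro K_closed) (auto intro: basis_tensor_0)

lemma pure_tensor_normal_form:
  assumes x: "x \<in> carrier heisenberg" and a: "a \<in> {0..<p}"
  shows "frag_of (x, a) - normal_form (frag_cmul a x) \<in> K"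
proof -
  \<comment> \<open>The relation for \<open>0 + 0\<close> is the negative of this tensor.\<close>
  have pure_zero: "frag_of (0, a) \<in> K"
    using K_closed(2)[OF K_add_left[of 0 0 a]] a by (simp add: heisenberg_simps)
  have "Poly_Mapping.keys x \<subseteq> {1..3}" using x by (simp add: heisenberg_simps)
  \<comment> \<open>Membership in the carrier is carried along because the difference step applies
    additivity to \<open>x - y\<close> and \<open>y\<close>.\<close>
  then have "x \<in> carrier heisenberg \<and> frag_of (x, a) - normal_form (frag_cmul a x) \<in> K"
  proof (induction x rule: frag_induction)
    case zero
    then show ?case using K_closed(4)[OF pure_zero normal_form_0] by (simp add: heisenberg_simps)
  next
    case (one k)
    have "frag_of (frag_of k, a) - normal_form (frag_cmul a (frag_of k)) \<in> K"
    proof -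
      have [simp]: "a mod p = a" using a by simp
      consider "k = 1" | "k = 2" | "k = 3" using one by fastforce
      then show ?thesis
      proof cases
        case 1
        have "- (basis_tensor 2 0 + basis_tensor 3 0) \<in> K" by (intro K_closed basis_tensor_0) auto
        then show ?thesis using 1 by (simp add: normal_form_def basis_tensor_def algebra_simps)
      next
        case 2
        have "- (basis_tensor 1 0 + basis_tensor 3 0) \<in> K" by (intro K_closed basis_tensor_0) auto
        then show ?thesis using 2 by (simp add: normal_form_def basis_tensor_def algebra_simps)
      next
        case 3
        have "- (basis_tensor 1 0 + basis_tensor 2 0) \<in> K" by (intro K_closed basis_tensor_0) auto
        then show ?thesis using 3 by (simp add: normal_form_def basis_tensor_def algebra_simps)
      qed
    qed
    then show ?case using one by (simp add: heisenberg_simps)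
  next
    case (diff x y)
    have xy: "x - y \<in> carrier heisenberg"
      using diff keys_diff[of x y] by (auto simp: heisenberg_simps)
    let ?n = "\<lambda>x. normal_form (frag_cmul a x)"
    have "?n (x - y) - (?n x - ?n y) \<in> K"
      using normal_form_diff by (simp add: frag_cmul_diff_right)
    \<comment> \<open>Subtraction is obtained from additivity by writing \<open>x\<close> as
      \<open>(x - y) + y\<close>.\<close>
    moreover have "frag_of (x, a) - frag_of (x - y, a) - frag_of (y, a) \<in> K"
      using K_add_left[OF xy _ a, of y] diff by simp
    ultimately have "(frag_of (x, a) - ?n x) - (frag_of (y, a) - ?n y)
        - (frag_of (x, a) - frag_of (x - y, a) - frag_of (y, a)) - (?n (x - y) - (?n x - ?n y)) \<in> K"
      using diff by (blast intro: K_closed(4))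
    then show ?case using xy by (simp add: algebra_simps)
  qed
  then show ?thesis by simp
qed

text \<open>Both terms respect differences modulo \<open>K\<close>, so the claim reduces to pure
  tensors.\<close>

lemma tensor_normal_form:
  assumes "f \<in> carrier F"
  shows "f - normal_form (tensor_eval f) \<in> K"
proof -
  have "Poly_Mapping.keys f \<subseteq> carrier heisenberg \<times> {0..<p}" using assms by (simp add: carrier_F)
  then show ?thesis
  proof (induction f rule: frag_induction)
    case zero
    then show ?case using K_closed(2)[OF normal_form_0] by simp
  next
    case (one xa)
    then show ?case by (cases xa) (auto intro: pure_tensor_normal_form)
  next
    case (diff f g)
    let ?n = "\<lambda>f. normal_form (tensor_eval f)"
    have "(f - ?n f) - (g - ?n g) - (?n (f - g) - (?n f - ?n g)) \<in> K"
      using K_closed(4)[OF K_closed(4)[OF diff] normal_form_diff[of "tensor_eval f" "tensor_eval g"]] by simp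
    then show ?case by (simp add: algebra_simps)
  qed
qed

text \<open>A formal sum with zero coordinates has the same normal form as 0, which lies in
  \<open>K\<close>; being congruent to it, the sum lies in \<open>K\<close> too.\<close>

lemma K_eq: "K = {f \<in> carrier F. coords f = (0, 0, 0)}"
proof (intro equalityI K_subset subsetI)
  fix f assume f: "f \<in> {f \<in> carrier F. coords f = (0, 0, 0)}"
  then have "normal_form (tensor_eval f) = normal_form 0"
    by (simp add: normal_form_def coords_def basis_tensor_def)
  moreover have "f - normal_form (tensor_eval f) \<in> K" using f by (intro tensor_normal_form) simp
  ultimately show "f \<in> K" using K_closed(3) normal_form_0 by fastforce
qed

section \<open>The tensor product as the set of fibres of the coordinate map\<close>

definition coset :: "int \<times> int \<times> int \<Rightarrow> ((nat \<Rightarrow>\<^sub>0 int) \<times> int \<Rightarrow>\<^sub>0 int) set" where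
  "coset v = {f \<in> carrier F. coords f = v}"

text \<open>Differing by an element of \<open>K\<close> means having equal coordinates, so the
  cosets of \<open>K\<close> are the fibres of \<open>coords\<close>.\<close>

lemma r_coset_K:
  assumes f: "f \<in> carrier F"
  shows "K #>\<^bsub>F\<^esub> f = coset (coords f)"
proof (intro equalityI subsetI)
  fix g assume "g \<in> K #>\<^bsub>F\<^esub> f"
  then obtain k where "k \<in> K" "g = k + f" by (auto simp: r_coset_def mult_F)
  then show "g \<in> coset (coords f)"
    using f by (auto simp: K_eq coset_def coords_eq_iff carrier_F_closed)
next
  fix g assume "g \<in> coset (coords f)"
  then have "g - f \<in> K" using f by (auto simp: K_eq coset_def coords_eq_iff carrier_F_closed)
  then show "g \<in> K #>\<^bsub>F\<^esub> f" by (force simp: r_coset_def mult_F)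
qed

lemma coords_surj:
  assumes "v \<in> V"
  obtains f where "f \<in> carrier F" "coords f = v"
proof -
  obtain x y z where v: "v = (x, y, z)" by (cases v)
  let ?f = "frag_of (frag_of 1, x) + frag_of (frag_of 2, y) + frag_of (frag_of 3, z)"
  have "?f \<in> carrier F"
    using assms v by (intro carrier_F_closed) (auto simp: frag_of_carrier_F heisenberg_simps)
  moreover have "coords ?f = v" using assms v by (simp add: coords_def lookup_add)
  ultimately show thesis by (rule that)
qed

lemma coset_nonempty: "v \<in> V \<Longrightarrow> coset v \<noteq> {}"
  by (rule coords_surj) (auto simp: coset_def)

lemma carrier_L: "carrier L = coset ` V"
proof -
  have "carrier L = coset ` coords ` carrier F"
    by (auto simp: extend_scalars_def Let_def FactGroup_def RCOSETS_def r_coset_K)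
  also have "coords ` carrier F = V"
  proof (intro equalityI subsetI)
    show "v \<in> V" if "v \<in> coords ` carrier F" for v using that coords_V by blast
    show "v \<in> coords ` carrier F" if v: "v \<in> V" for v
      using coords_surj[OF v] by blast
  qed
  finally show ?thesis .
qed

lemma inj_on_coset: "inj_on coset V"
proof (rule inj_onI)
  fix u v assume u: "u \<in> V" and eq: "coset u = coset v"
  obtain f where "f \<in> coset u" using coset_nonempty[OF u] by blast
  moreover from this have "f \<in> coset v" unfolding eq .
  ultimately show "u = v" by (simp add: coset_def)
qed

lemma normal_K: "K \<lhd> F"
  using comm_group.normal_iff_subgroup[OF comm_group_F] subgroup_K by blast

lemma group_L: "group (add_monoid L)"
proof -
  have "carrier L = carrier (F Mod K)" "(\<oplus>\<^bsub>L\<^esub>) = (\<otimes>\<^bsub>F Mod K\<^esub>)" "\<zero>\<^bsub>L\<^esub> = \<one>\<^bsub>F Mod K\<^esub>"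
    by (simp_all add: extend_scalars_def Let_def)
  then show ?thesis
    using normal.factorgroup_is_group[OF normal_K]
    by (simp add: group_def monoid_def group_axioms_def Units_def)
qed

lemma coset_add:
  assumes "u \<in> V" "v \<in> V"
  shows "coset (u \<oplus>\<^bsub>A\<^esub> v) = coset u \<oplus>\<^bsub>L\<^esub> coset v"
proof -
  obtain f where f: "f \<in> carrier F" "coords f = u" using assms(1) by (rule coords_surj)
  obtain g where g: "g \<in> carrier F" "coords g = v" using assms(2) by (rule coords_surj)
  have "coset u \<oplus>\<^bsub>L\<^esub> coset v = (K #>\<^bsub>F\<^esub> f) <#>\<^bsub>F\<^esub> (K #>\<^bsub>F\<^esub> g)"
    using f g by (simp add: r_coset_K extend_scalars_def Let_def FactGroup_def)
  also have "\<dots> = K #>\<^bsub>F\<^esub> (f + g)"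
    using normal.rcos_sum[OF normal_K f(1) g(1)] by (simp add: mult_F)
  also have "\<dots> = coset (u \<oplus>\<^bsub>A\<^esub> v)"
    using f g by (simp add: r_coset_K carrier_F_closed coords_add)
  finally show ?thesis by simp
qed

text \<open>Multiplication in \<open>L\<close> is a union over representatives. Each contributes the
  same coset, and since the fibre is nonempty the union is that coset.\<close>

lemma coset_smult:
  assumes c: "c \<in> carrier Fp" and v: "v \<in> V"
  shows "coset (c \<odot>\<^bsub>A\<^esub> v) = c \<odot>\<^bsub>L\<^esub> coset v"
proof -
  let ?s = "frag_extend (\<lambda>(x, a). frag_of (x, c * a mod p))"
  have carrier: "?s f \<in> carrier F" if "f \<in> carrier F" for f
    using that p_pos
    by (intro frag_extend_carrier_F) (auto simp: frag_of_carrier_F carrier_F)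
  have "Poly_Mapping.lookup (tensor_eval (?s f)) k mod p
      = c * Poly_Mapping.lookup (tensor_eval f) k mod p"
    for f :: "(nat \<Rightarrow>\<^sub>0 int) \<times> int \<Rightarrow>\<^sub>0 int" and k
    using subset_UNIV[of "Poly_Mapping.keys f"]
  proof (induction f rule: frag_induction)
    case (one xa)
    show ?case by (cases xa) (simp add: mod_mult_left_eq mult.assoc)
  next
    case (diff f g)
    show ?case
      using mod_diff_cong[OF diff]
      by (simp add: frag_extend_diff lookup_minus right_diff_distrib)
  qed simp
  then have "coords (?s f) = c \<odot>\<^bsub>A\<^esub> coords f" for f
    by (simp add: coords_def heis_mod_def mod_mult_right_eq)
  then have "K #>\<^bsub>F\<^esub> ?s f = coset (c \<odot>\<^bsub>A\<^esub> v)" if "f \<in> coset v" for f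
    using that carrier by (simp add: coset_def r_coset_K)
  then show ?thesis using coset_nonempty[OF v] by (simp add: extend_scalars_def Let_def residue_ring_def)
qed

lemma coset_bracket:
  assumes uv: "u \<in> V" "v \<in> V"
  shows "coset (lie_bracket A u v) = lie_bracket L (coset u) (coset v)"
proof -
  let ?b = "\<lambda>f g. frag_extend (\<lambda>(x, a). frag_extend (\<lambda>(y, b).
    frag_of (lie_bracket heisenberg x y, a * b mod p)) g) f"
  have "lie_bracket heisenberg x y \<in> carrier heisenberg" for x y
    by (auto simp: heisenberg_bracket heisenberg_simps)
  then have carrier: "?b f g \<in> carrier F" for f g
    using p_pos
    by (intro frag_extend_carrier_F)
       (simp add: case_prod_unfold frag_extend_carrier_F frag_of_carrier_F)
  let ?l = "Poly_Mapping.lookup :: (nat \<Rightarrow>\<^sub>0 int) \<Rightarrow> nat \<Rightarrow> int"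
  have bracket_diff:
    "?l (lie_bracket heisenberg (x - x') y) k = ?l (lie_bracket heisenberg x y) k - ?l (lie_bracket heisenberg x' y) k"
    "?l (lie_bracket heisenberg x (y - y')) k = ?l (lie_bracket heisenberg x y) k - ?l (lie_bracket heisenberg x y') k"
    for x x' y y' k
    by (auto simp: heisenberg_bracket lookup_minus algebra_simps)
  \<comment> \<open>Both sides respect differences in each argument, so an induction in
    \<open>f\<close> and one in \<open>g\<close> reduce to pure tensors. There equality holds only
    modulo \<open>p\<close>, as the product of scalars is reduced.\<close>
  have eval: "?l (tensor_eval (?b f g)) k mod p
      = ?l (lie_bracket heisenberg (tensor_eval f) (tensor_eval g)) k mod p" for f g k
    using subset_UNIV[of "Poly_Mapping.keys f"]
  proof (induction f rule: frag_induction)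
    case zero
    then show ?case by (simp add: heisenberg_bracket)
  next
    case (diff f f')
    show ?case
      using mod_diff_cong[OF diff] by (simp add: frag_extend_diff lookup_minus bracket_diff)
  next
    case (one xa)
    obtain x a where xa: "xa = (x, a)" by (cases xa)
    from subset_UNIV[of "Poly_Mapping.keys g"] show ?case unfolding xa
    proof (induction g rule: frag_induction)
      case zero
      then show ?case by (simp add: heisenberg_bracket)
    next
      case (diff g g')
      show ?case
        using mod_diff_cong[OF diff] by (simp add: frag_extend_diff lookup_minus bracket_diff)
    next
      case (one yb)
      obtain y b where yb: "yb = (y, b)" by (cases yb)
      have "?l (lie_bracket heisenberg (frag_cmul a x) (frag_cmul b y)) k
          = a * b * ?l (lie_bracket heisenberg x y) k"
        by (simp add: heisenberg_bracket algebra_simps)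
      then show ?case unfolding yb by (simp add: mod_mult_left_eq)
    qed
  qed
  have "coords (?b f g) = lie_bracket A (coords f) (coords g)" for f g
    unfolding coords_def eval by (simp add: heisenberg_bracket heis_mod_def mod_minor)
  then have "K #>\<^bsub>F\<^esub> ?b f g = coset (lie_bracket A u v)" if "f \<in> coset u" "g \<in> coset v" for f g
    using that carrier by (simp add: coset_def r_coset_K)
  then show ?thesis using uv[THEN coset_nonempty] by (simp add: extend_scalars_def Let_def residue_ring_def)
qed

lemma lie_iso_coset: "lie_iso Fp A L coset"
proof (rule lie_iso.intro)
  show "group (add_monoid A)" by (rule group_A)
  show "group (add_monoid L)" by (rule group_L)
  show "coset \<in> iso (add_monoid A) (add_monoid L)"
    by (auto simp: iso_def hom_def bij_betw_def carrier_A carrier_L inj_on_coset coset_add)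
next
  fix a u assume u: "a \<in> carrier Fp" "u \<in> carrier A"
  then show "coset (a \<odot>\<^bsub>A\<^esub> u) = a \<odot>\<^bsub>L\<^esub> coset u" by (simp add: coset_smult carrier_A)
  show "a \<odot>\<^bsub>A\<^esub> u \<in> carrier A" using p_pos by (cases u) (simp add: heis_mod_def)
next
  fix u v assume "u \<in> carrier A" "v \<in> carrier A"
  then show "coset (lie_bracket A u v) = lie_bracket L (coset u) (coset v)"
    by (simp add: coset_bracket carrier_A)
  show "lie_bracket A u v \<in> carrier A"
    using p_pos by (cases u; cases v) (simp add: heis_mod_def)
qed (rule finite_A)

end

section \<open>Assembling the zeta polynomials\<close>

theorem theorem2p6:
  fixes p :: nat and s t :: complex
  assumes "prime p" and "t = (of_nat p :: complex) powr (- s)"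
  shows "zeta_ideal heisenberg p s = 1 + (1 + of_nat p) * t + t ^ 2 + t ^ 3
    \<and> zeta_subalgebra heisenberg p s
        = 1 + (1 + of_nat p) * t + (1 + of_nat p + of_nat p ^ 2) * t ^ 2 + t ^ 3"
proof -
  interpret heis_residues "int p" using assms by unfold_locales simp
  interpret lie_iso Fp A L coset by (rule lie_iso_coset)
  have L: "L = Fp_points heisenberg p" by (simp add: Fp_points_def)
  have p: "p > 0" using assms(1) by (rule prime_gt_0_nat)
  \<comment> \<open>Index \<open>p ^ i\<close> is paired with cardinality
    \<open>p ^ (3 - i)\<close>, so codimension is turned into dimension.\<close>
  have k: "p ^ 0 * p ^ 3 = card (carrier A)" "p ^ 1 * p ^ 2 = card (carrier A)"
    "p ^ 2 * p = card (carrier A)" "p ^ 3 * 1 = card (carrier A)"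
    unfolding card_V by (simp_all add: power2_eq_square power3_eq_cube)
  note ideals = k[THEN num_ideals_eq, unfolded L] and subalgebras = k[THEN num_subalgebras_eq, unfolded L]
  have sum: "(\<Sum>i = 0..lie_rank heisenberg. f i) = f 0 + f 1 + f 2 + f 3" for f :: "nat \<Rightarrow> complex"
    by (simp add: lie_rank_heisenberg numeral_eq_Suc)
  show ?thesis
    unfolding zeta_ideal_def zeta_subalgebra_def sum assms(2)[symmetric]
    using p by (simp add: ideals subalgebras count_ideals[unfolded nat_int]
        count_subalgebras[unfolded nat_int] del: One_nat_def power_0 power_one_right) simp
qed

end
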